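(* Let $D\subset\mathbb{R}^n$ be an open domain and let $f:D\to\mathbb{R}^m$ be a smooth function. Let $M=\{(x,f(x)):x\in D\}\subset\mathbb{R}^n\times\mathbb{R}^m=\mathbb{R}^{n+m}$ be the graph of $f$. If $M$ is a minimal submanifold of $\mathbb{R}^{n+m}$ which has constant Jordan angles (CJA) relative to the coordinate $m$-plane $Q_0=\{0\}\times\mathbb{R}^m$, and if $g^N\le 2$ and $g^T\le 2$, then $f$ is affine linear, i.e. $M$ is (an open piece of) an affine $n$-plane.
   Context: Domains are connected. A submanifold of Euclidean space is minimal if its mean curvature vector (the trace of its second fundamental form) vanishes identically. Jordan angles: for two linear subspaces $P,Q$ of the same dimension in Euclidean space, with orthogonal projections $\mathcal{P}$ onto $P$ and $\mathcal{P}_Q$ onto $Q$, a number $\theta\in[0,\pi/2]$ is a Jordan angle between $P$ and $Q$ if $\cos^2\theta$ is an eigenvalue of the self-adjoint operator $(\mathcal{P}\circ\mathcal{P}_Q)|_P:P\to P$; its multiplicity is the dimension of the corresponding eigenspace (equivalently, Jordan angles are the critical values of the angle between a nonzero $u\in P$ and its projection to $Q$). $\mathrm{Arg}(P,Q)$ is the set of Jordan angles. CJA: an $n$-dimensional submanifold $M\subset\mathbb{R}^{n+m}$ has constant Jordan angles (CJA) relative to a fixed $m$-plane $Q_0$ if the set $\mathrm{Arg}(N_pM,Q_0)$ of Jordan angles between the normal space $N_pM$ and $Q_0$, together with the multiplicities, is independent of $p\in M$. Then $\mathrm{Arg}(T_pM,Q_0^\perp)$ and its multiplicities are also independent of $p$.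 Write $\mathrm{Arg}^N=\mathrm{Arg}(N_pM,Q_0)$, $\mathrm{Arg}^T=\mathrm{Arg}(T_pM,Q_0^\perp)$, $g^N=|\mathrm{Arg}^N|$, $g^T=|\mathrm{Arg}^T|$ (numbers of distinct angles). *)

theory Defs
  imports "HOL-Analysis.Analysis"
begin

text \<open>
  Smoothness is only meaningful here for open \<open>S\<close>, because \<open>frechet_derivative f (at x)\<close> is the
  unrestricted derivative. On a finite-dimensional domain, asking that every directional derivative
  \<open>\<lambda>x. Df(x) v\<close> be of class \<open>C\<^sup>k\<close> is the same as asking that \<open>Df\<close> be of class \<open>C\<^sup>k\<close>.
\<close>

primrec Ck_on :: "nat \<Rightarrow> 'a::real_normed_vector set \<Rightarrow> ('a \<Rightarrow> 'b::real_normed_vector) \<Rightarrow> bool" where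
  "Ck_on 0 S f \<longleftrightarrow> continuous_on S f"
| "Ck_on (Suc k) S f \<longleftrightarrow>
     f differentiable_on S \<and> (\<forall>v. Ck_on k S (\<lambda>x. frechet_derivative f (at x) v))"

definition smooth_on :: "'a::real_normed_vector set \<Rightarrow> ('a \<Rightarrow> 'b::real_normed_vector) \<Rightarrow> bool" where
  "smooth_on S f \<longleftrightarrow> (\<forall>k. Ck_on k S f)"

definition orth_proj :: "'e::euclidean_space set \<Rightarrow> 'e \<Rightarrow> 'e" where
  "orth_proj P x = (THE y. y \<in> P \<and> x - y \<in> P\<^sup>\<bottom>)"

text \<open>
  The following notions are meant for smooth embedded submanifolds \<open>M\<close> of a Euclidean space. They
  are stated for arbitrary subsets; the graph of a smooth function on an open set is always such a
  submanifold.
\<close>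

definition tangent_space :: "'e::euclidean_space set \<Rightarrow> 'e \<Rightarrow> 'e set" where
  "tangent_space M p =
     {vector_derivative \<gamma> (at 0) | \<gamma> \<epsilon>.
        0 < \<epsilon> \<and> smooth_on {-\<epsilon><..<\<epsilon>} \<gamma> \<and> \<gamma> ` {-\<epsilon><..<\<epsilon>} \<subseteq> M \<and> \<gamma> (0::real) = p}"

definition normal_space :: "'e::euclidean_space set \<Rightarrow> 'e \<Rightarrow> 'e set" where
  "normal_space M p = (tangent_space M p)\<^sup>\<bottom>"

text \<open>
  \<open>W\<close> is a smooth vector field on a neighbourhood of \<open>p\<close> in the ambient space which is tangent to
  \<open>M\<close> along \<open>M\<close> and takes the value \<open>Y\<close> at \<open>p\<close>.
\<close>

definition tangent_extension ::
  "'e::euclidean_space set \<Rightarrow> 'e \<Rightarrow> 'e \<Rightarrow> ('e \<Rightarrow> 'e) \<Rightarrow> bool" where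
  "tangent_extension M p Y W \<longleftrightarrow>
     (\<exists>U. open U \<and> p \<in> U \<and> smooth_on U W \<and> (\<forall>q\<in>U \<inter> M. W q \<in> tangent_space M q)) \<and> W p = Y"

text \<open>
  \<open>B(X,Y) = (D\<^sub>X W)\<^sup>N\<close> for any extension \<open>W\<close> of \<open>Y\<close> to a field tangent to \<open>M\<close>; for a submanifold
  such a \<open>W\<close> exists and the value does not depend on it.
\<close>

definition second_fundamental_form ::
  "'e::euclidean_space set \<Rightarrow> 'e \<Rightarrow> 'e \<Rightarrow> 'e \<Rightarrow> 'e" where
  "second_fundamental_form M p X Y =
     (let W = (SOME W. tangent_extension M p Y W)
      in orth_proj (normal_space M p) (frechet_derivative W (at p) X))"

definition orthonormal_basis :: "'e::euclidean_space set \<Rightarrow> 'e set \<Rightarrow> bool" where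
  "orthonormal_basis V E \<longleftrightarrow> pairwise orthogonal E \<and> (\<forall>e\<in>E. norm e = 1) \<and> span E = V"

text \<open>The trace does not depend on the orthonormal basis chosen.\<close>

definition mean_curvature :: "'e::euclidean_space set \<Rightarrow> 'e \<Rightarrow> 'e" where
  "mean_curvature M p =
     (\<Sum>e\<in>(SOME E. orthonormal_basis (tangent_space M p) E). second_fundamental_form M p e e)"

definition minimal_submanifold :: "'e::euclidean_space set \<Rightarrow> bool" where
  "minimal_submanifold M \<longleftrightarrow> (\<forall>p\<in>M. mean_curvature M p = 0)"

definition jordan_eigenspace ::
  "'e::euclidean_space set \<Rightarrow> 'e set \<Rightarrow> real \<Rightarrow> 'e set" where
  "jordan_eigenspace P Q \<theta> = {u \<in> P. orth_proj P (orth_proj Q u) = (cos \<theta>)\<^sup>2 *\<^sub>R u}"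

text \<open>\<open>Arg(P,Q)\<close>; it has at most \<open>dim P\<close> elements when \<open>P\<close> and \<open>Q\<close> are subspaces.\<close>

definition jordan_angles :: "'e::euclidean_space set \<Rightarrow> 'e set \<Rightarrow> real set" where
  "jordan_angles P Q = {\<theta>. 0 \<le> \<theta> \<and> \<theta> \<le> pi / 2 \<and> (\<exists>u\<in>jordan_eigenspace P Q \<theta>. u \<noteq> 0)}"

definition jordan_multiplicity :: "'e::euclidean_space set \<Rightarrow> 'e set \<Rightarrow> real \<Rightarrow> nat" where
  "jordan_multiplicity P Q \<theta> = dim (jordan_eigenspace P Q \<theta>)"

definition constant_jordan_angles :: "'e::euclidean_space set \<Rightarrow> 'e set \<Rightarrow> bool" where
  "constant_jordan_angles M Q \<longleftrightarrow>
     (\<forall>p\<in>M. \<forall>q\<in>M.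
        jordan_angles (normal_space M p) Q = jordan_angles (normal_space M q) Q \<and>
        (\<forall>\<theta>\<in>jordan_angles (normal_space M p) Q.
           jordan_multiplicity (normal_space M p) Q \<theta> = jordan_multiplicity (normal_space M q) Q \<theta>))"

text \<open>
  The numbers \<open>g\<^sup>N\<close> and \<open>g\<^sup>T\<close> of distinct angles, at a point \<open>p\<close>. Both are independent of \<open>p\<close>
  when \<open>M\<close> has constant Jordan angles relative to \<open>Q\<close>.
\<close>

definition gN :: "'e::euclidean_space set \<Rightarrow> 'e set \<Rightarrow> 'e \<Rightarrow> nat" where
  "gN M Q p = card (jordan_angles (normal_space M p) Q)"

definition gT :: "'e::euclidean_space set \<Rightarrow> 'e set \<Rightarrow> 'e \<Rightarrow> nat" where
  "gT M Q p = card (jordan_angles (tangent_space M p) (Q\<^sup>\<bottom>))"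

end

theory Submission
  imports Defs
begin

text \<open>
  Write \<open>A = Df\<close>, \<open>h = A\<^sup>* A\<close>. The Jordan angles of the normal and tangent spaces of the graph are the
  \<open>arctan \<surd>\<mu>\<close> for \<open>\<mu>\<close> an eigenvalue of \<open>A A\<^sup>*\<close> and of \<open>h\<close>, and these operators have the same nonzero
  eigenvalues. So there are constants \<open>a \<noteq> b\<close> with \<open>(h - a)(h - b) = 0\<close>, and either \<open>b = 0\<close> or \<open>A\<close> is
  everywhere surjective. Differentiating this identity shows that \<open>\<langle>D\<^sup>2f(X, Y), A Z\<rangle> = 0\<close> whenever
  \<open>X\<close>, \<open>Y\<close>, \<open>Z\<close> lie in one eigenspace of \<open>h\<close>, and that \<open>tr h = |Df|\<^sup>2\<close> is constant. The minimal surface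
  equation is a combination with positive coefficients of the traces of \<open>D\<^sup>2f\<close> over the two
  eigenspaces; by the first fact both traces are orthogonal to the image of \<open>A\<close>. If \<open>A\<close> is surjective
  they vanish; if \<open>b = 0\<close>, differentiating \<open>A h = a A\<close> shows that the trace over the kernel of \<open>h\<close> also
  lies in the image of \<open>A\<close>, so again both vanish. Thus \<open>\<Delta>f = 0\<close>, and Bochner's formula
  \<open>\<Delta>|Df|\<^sup>2 / 2 = |D\<^sup>2f|\<^sup>2 + \<langle>D\<Delta>f, Df\<rangle>\<close> yields \<open>D\<^sup>2f = 0\<close>.
\<close>

subsection \<open>Self-adjoint operators\<close>

text \<open>Expanding \<open>L b\<close> in the basis turns both sides into one double sum, whose
  coefficient matrix \<open>L b \<bullet> c\<close> is symmetric.\<close>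

lemma sum_Basis_self_adjoint:
  fixes B :: "'a::euclidean_space \<Rightarrow> 'a \<Rightarrow> 'b::real_vector"
  assumes B1: "\<And>y. linear (\<lambda>x. B x y)" and B2: "\<And>x. linear (B x)"
    and sa: "\<And>x y. L x \<bullet> y = x \<bullet> L y"
  shows "(\<Sum>b\<in>Basis. B b (L b)) = (\<Sum>b\<in>Basis. B (L b) b)"
proof -
  have "(\<Sum>b\<in>Basis. B b (L b)) = (\<Sum>b\<in>Basis. \<Sum>c\<in>Basis. (L b \<bullet> c) *\<^sub>R B b c)"
  proof (rule sum.cong[OF refl])
    fix b :: 'a
    have "B b (L b) = B b (\<Sum>c\<in>Basis. (L b \<bullet> c) *\<^sub>R c)" by (simp add: euclidean_representation)
    also have "\<dots> = (\<Sum>c\<in>Basis. (L b \<bullet> c) *\<^sub>R B b c)"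
      by (simp add: linear_sum[OF B2] linear_cmul[OF B2])
    finally show "B b (L b) = (\<Sum>c\<in>Basis. (L b \<bullet> c) *\<^sub>R B b c)" .
  qed
  also have "\<dots> = (\<Sum>c\<in>Basis. \<Sum>b\<in>Basis. (L c \<bullet> b) *\<^sub>R B b c)"
    by (subst sum.swap) (intro sum.cong refl, metis sa inner_commute)
  also have "\<dots> = (\<Sum>c\<in>Basis. B (L c) c)"
  proof (rule sum.cong[OF refl])
    fix c :: 'a
    have "B (L c) c = B (\<Sum>b\<in>Basis. (L c \<bullet> b) *\<^sub>R b) c" by (simp add: euclidean_representation)
    also have "\<dots> = (\<Sum>b\<in>Basis. (L c \<bullet> b) *\<^sub>R B b c)"
      by (simp add: linear_sum[OF B1] linear_cmul[OF B1])
    finally show "(\<Sum>b\<in>Basis. (L c \<bullet> b) *\<^sub>R B b c) = B (L c) c" by simp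
  qed
  finally show ?thesis .
qed

text \<open>A maximiser \<open>v\<close> of the Rayleigh quotient on the unit sphere of
  \<open>V\<close> is an eigenvector: the residual \<open>r\<close> lies in \<open>V\<close> by
  invariance, and moving from \<open>v\<close> along \<open>r\<close> would raise the quotient
  unless \<open>r = 0\<close>.\<close>

lemma self_adjoint_eigenvector_exists:
  fixes h :: "'a::euclidean_space \<Rightarrow> 'a"
  assumes lin: "linear h" and sa: "\<And>x y. h x \<bullet> y = x \<bullet> h y"
    and V: "subspace V" "h ` V \<subseteq> V" "V \<noteq> {0}"
  obtains u \<mu> where "u \<in> V" "u \<noteq> 0" "h u = \<mu> *\<^sub>R u"
proof -
  let ?S = "sphere 0 1 \<inter> V"
  obtain w where w: "w \<in> V" "w \<noteq> 0" using V subspace_0 by fast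
  have "w /\<^sub>R norm w \<in> ?S" using w V(1) by (simp add: subspace_scale)
  then have ne: "?S \<noteq> {}" by blast
  have "compact ?S" using closed_subspace[OF V(1)] compact_sphere by (rule compact_Int_closed[rotated])
  moreover have "continuous_on ?S (\<lambda>x. h x \<bullet> x)"
    using lin by (intro continuous_on_inner continuous_on_id linear_continuous_on)
      (simp add: linear_conv_bounded_linear)
  ultimately obtain v where v: "v \<in> ?S" and vmax: "\<And>x. x \<in> ?S \<Longrightarrow> h x \<bullet> x \<le> h v \<bullet> v"
    using continuous_attains_sup[OF _ ne] by blast
  define M where "M = h v \<bullet> v"
  have le: "h x \<bullet> x \<le> M * (x \<bullet> x)" if "x \<in> V" for x
  proof (cases "x = 0")
    case False
    have "x /\<^sub>R norm x \<in> ?S" using that False V(1) by (simp add: subspace_scale)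
    from vmax[OF this] False show ?thesis
      by (simp add: M_def linear_cmul[OF lin] power2_norm_eq_inner[symmetric] field_simps power2_eq_square)
  qed (simp add: linear_0[OF lin])
  define r where "r = M *\<^sub>R v - h v"
  have vV: "v \<in> V" and vv: "v \<bullet> v = 1" using v by (auto simp: norm_eq_1)
  have rV: "r \<in> V" unfolding r_def using vV V by (intro subspace_diff subspace_scale) auto
  define R where "R = r \<bullet> r"
  define K where "K = M * R - h r \<bullet> r"
  have K: "K \<ge> 0" using le[OF rV] by (simp add: K_def R_def)
  \<comment> \<open>Test the bound \<open>le\<close> at \<open>v + t *\<^sub>R r\<close>: the
    constant terms cancel, and the linear coefficient is twice
    \<open>(M *\<^sub>R v - h v) \<bullet> r = R\<close>.\<close>
  have ineq: "0 \<le> 2 * t * R + t\<^sup>2 * K" for t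
  proof -
    have e: "M * (v \<bullet> r) - h v \<bullet> r = R" unfolding R_def r_def by (simp add: inner_diff_left)
    have "h (v + t *\<^sub>R r) \<bullet> (v + t *\<^sub>R r) \<le> M * ((v + t *\<^sub>R r) \<bullet> (v + t *\<^sub>R r))"
      using le vV rV V(1) by (simp add: subspace_add subspace_scale)
    then have "0 \<le> 2 * t * (M * (v \<bullet> r) - h v \<bullet> r) + t\<^sup>2 * K"
      using sa[of r v] M_def
      by (simp add: linear_add[OF lin] linear_cmul[OF lin] inner_simps vv K_def R_def
          inner_commute power2_eq_square algebra_simps)
    then show ?thesis by (simp add: e)
  qed
  have "R = 0"
  proof (rule ccontr)
    assume "R \<noteq> 0"
    then have Rp: "R > 0" by (simp add: R_def)
    \<comment> \<open>The quadratic in \<open>t\<close> is negative for small negative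
      \<open>t\<close>; the denominator \<open>K + 1\<close> covers the case \<open>K = 0\<close> as
      well.\<close>
    have "2 * (- R / (K + 1)) * R + (- R / (K + 1))\<^sup>2 * K = - (R\<^sup>2 * (K + 2)) / (K + 1)\<^sup>2"
      using K by (simp add: power2_eq_square divide_simps) (simp add: algebra_simps)
    also have "\<dots> < 0" using Rp K by (simp add: divide_neg_pos)
    finally show False using ineq[of "- R / (K + 1)"] by linarith
  qed
  then have "h v = M *\<^sub>R v" by (simp add: R_def r_def)
  moreover have "v \<noteq> 0" using vv by auto
  ultimately show ?thesis using that vV by blast
qed

definition eigenvalues :: "('a::real_vector \<Rightarrow> 'a) \<Rightarrow> real set" where
  "eigenvalues h = {\<mu>. \<exists>u. u \<noteq> 0 \<and> h u = \<mu> *\<^sub>R u}"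

text \<open>The range of \<open>k = (h - a)(h - b)\<close> is invariant under \<open>h\<close>. If
  it were nonzero it would contain an eigenvector \<open>u = k w\<close>; then
  \<open>k u = 0\<close>, so \<open>u \<bullet> u = w \<bullet> k u = 0\<close>. With only an
  inclusion of the spectrum assumed, \<open>a\<close> or \<open>b\<close> may be a dummy
  value.\<close>

lemma self_adjoint_quadratic:
  fixes h :: "'a::euclidean_space \<Rightarrow> 'a"
  assumes lin: "linear h" and sa: "\<And>x y. h x \<bullet> y = x \<bullet> h y"
    and ev: "eigenvalues h \<subseteq> {a, b}"
  shows "h (h x) = (a + b) *\<^sub>R h x - (a * b) *\<^sub>R x"
proof -
  define k where "k x = h (h x) - (a + b) *\<^sub>R h x + (a * b) *\<^sub>R x" for x
  have k: "linear k" unfolding k_def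
    by (intro linear_compose_add linear_compose_sub linear_compose_scale_right
        linear_compose[OF lin lin, unfolded o_def] lin linear_id[unfolded id_def])
  have ksa: "k x \<bullet> y = x \<bullet> k y" for x y by (simp add: k_def inner_simps sa)
  have hk: "h (k x) = k (h x)" for x
    by (simp add: k_def linear_add[OF lin] linear_diff[OF lin] linear_cmul[OF lin])
  have "range k = {0}"
  proof (rule ccontr)
    assume "range k \<noteq> {0}"
    moreover have "subspace (range k)" by (intro linear_subspace_image k subspace_UNIV)
    moreover have "h ` range k \<subseteq> range k" using hk by auto
    ultimately obtain u \<mu> where u: "u \<in> range k" "u \<noteq> 0" "h u = \<mu> *\<^sub>R u"
      using self_adjoint_eigenvector_exists[OF lin sa] by metis
    have "k u = ((\<mu> - a) * (\<mu> - b)) *\<^sub>R u"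
      by (simp add: k_def u linear_cmul[OF lin] algebra_simps)
    also have "\<dots> = 0" using ev u(2,3) unfolding eigenvalues_def by auto
    finally have "k u = 0" .
    obtain w where "u = k w" using u(1) by auto
    then have "u \<bullet> u = w \<bullet> k u" using ksa by simp
    with \<open>k u = 0\<close> u(2) show False by simp
  qed
  then have "k x = 0" by auto
  then show ?thesis by (simp add: k_def algebra_simps)
qed

text \<open>Eigenvectors for distinct eigenvalues are orthogonal, hence independent. Finiteness is
  what gives force to bounds on \<open>card\<close>, which is 0 on infinite sets.\<close>

lemma finite_self_adjoint_eigenvalues:
  fixes h :: "'a::euclidean_space \<Rightarrow> 'a"
  assumes sa: "\<And>x y. h x \<bullet> y = x \<bullet> h y"
  shows "finite (eigenvalues h)"
proof -
  let ?E = "{\<mu>. \<exists>u. u \<noteq> 0 \<and> h u = \<mu> *\<^sub>R u}"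
  obtain v where v: "\<And>\<mu>. \<mu> \<in> ?E \<Longrightarrow> v \<mu> \<noteq> 0 \<and> h (v \<mu>) = \<mu> *\<^sub>R v \<mu>"
    using bchoice[of ?E "\<lambda>\<mu> u. u \<noteq> 0 \<and> h u = \<mu> *\<^sub>R u"] by blast
  have orth: "v \<mu> \<bullet> v \<nu> = 0" if "\<mu> \<in> ?E" "\<nu> \<in> ?E" "\<mu> \<noteq> \<nu>" for \<mu> \<nu>
    using sa[of "v \<mu>" "v \<nu>"] v[OF that(1)] v[OF that(2)] that(3) by auto
  have inj: "inj_on v ?E"
  proof (rule inj_onI, rule ccontr)
    fix \<mu> \<nu> assume *: "\<mu> \<in> ?E" "\<nu> \<in> ?E" "v \<mu> = v \<nu>" "\<mu> \<noteq> \<nu>"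
    then show False using orth[OF *(1,2,4)] v[OF *(1)] by simp
  qed
  have "pairwise orthogonal (v ` ?E)"
    unfolding pairwise_def orthogonal_def using orth by (metis (no_types, lifting) imageE)
  moreover have "0 \<notin> v ` ?E" using v by (metis (no_types, lifting) imageE)
  ultimately have "finite (v ` ?E)"
    by (intro independent_imp_finite pairwise_orthogonal_independent)
  then show ?thesis using inj unfolding eigenvalues_def by (rule finite_imageD)
qed

section \<open>Orthogonal projections, characterised without \<open>THE\<close>\<close>

lemma orth_proj_unique:
  fixes P :: "'e::euclidean_space set"
  assumes P: "subspace P"
  shows "orth_proj P x = y \<longleftrightarrow> y \<in> P \<and> x - y \<in> P\<^sup>\<bottom>"
proof -
  have "\<exists>!y. y \<in> P \<and> x - y \<in> P\<^sup>\<bottom>"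
  proof (rule ex_ex1I)
    show "\<exists>y. y \<in> P \<and> x - y \<in> P\<^sup>\<bottom>"
    proof -
      obtain y z where "y \<in> P" "z \<in> P\<^sup>\<bottom>" "x = y + z"
        using subspace_sum_orthogonal_comp[OF P] by (metis UNIV_I set_plus_elim)
      then show ?thesis by (intro exI[of _ y]) simp
    qed
  next
    fix y z assume *: "y \<in> P \<and> x - y \<in> P\<^sup>\<bottom>" "z \<in> P \<and> x - z \<in> P\<^sup>\<bottom>"
    have "(x - z) - (x - y) \<in> P\<^sup>\<bottom>" using * subspace_orthogonal_comp subspace_diff by blast
    moreover have "y - z \<in> P" using * P subspace_diff by blast
    ultimately have "orthogonal (y - z) (y - z)" unfolding orthogonal_comp_def by simp
    then show "y = z" by (simp add: orthogonal_def)
  qed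
  then have "orth_proj P x \<in> P \<and> x - orth_proj P x \<in> P\<^sup>\<bottom>"
    unfolding orth_proj_def by (rule theI')
  with \<open>\<exists>!y. _\<close> show ?thesis by blast
qed

subsection \<open>Symmetry of second derivatives\<close>

text \<open>Mean value theorem twice: in \<open>s\<close> for \<open>F s h - F s 0\<close>, then in
  \<open>t\<close> for \<open>Fs s\<close>.\<close>

lemma mixed_difference_mean_value:
  fixes F Fs Fst :: "real \<Rightarrow> real \<Rightarrow> real"
  assumes h: "h > 0"
    and Fs: "\<And>s t. \<lbrakk>0 \<le> s; s \<le> h; 0 \<le> t; t \<le> h\<rbrakk> \<Longrightarrow> ((\<lambda>s. F s t) has_real_derivative Fs s t) (at s)"
    and Fst: "\<And>s t. \<lbrakk>0 \<le> s; s \<le> h; 0 \<le> t; t \<le> h\<rbrakk> \<Longrightarrow> (Fs s has_real_derivative Fst s t) (at t)"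
  obtains s t where "0 < s" "s < h" "0 < t" "t < h" "F h h - F h 0 - F 0 h + F 0 0 = h\<^sup>2 * Fst s t"
proof -
  have "((\<lambda>s. F s h - F s 0) has_real_derivative Fs s h - Fs s 0) (at s)" if "0 \<le> s" "s \<le> h" for s
    using that h by (intro derivative_intros Fs) auto
  from MVT2[OF h this] obtain s where
    s: "0 < s" "s < h" "F h h - F h 0 - (F 0 h - F 0 0) = h * (Fs s h - Fs s 0)" by auto
  have "(Fs s has_real_derivative Fst s t) (at t)" if "0 \<le> t" "t \<le> h" for t
    using that s by (intro Fst) auto
  from MVT2[OF h this] obtain t where t: "0 < t" "t < h" "Fs s h - Fs s 0 = h * Fst s t" by auto
  with s that show ?thesis by (simp add: power2_eq_square)
qed

text \<open>One mixed difference over a small parallelogram is \<open>h\<^sup>2\<close> times either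
  mixed derivative, each at some nearby point; continuity at \<open>x\<close> then forces them to
  agree.\<close>

lemma continuous_second_derivatives_symmetric_real:
  fixes f :: "'a::real_normed_vector \<Rightarrow> real"
  assumes S: "open S" "x \<in> S"
    and f: "\<And>y. y \<in> S \<Longrightarrow> (f has_derivative f' y) (at y)"
    and fu: "\<And>y. y \<in> S \<Longrightarrow> ((\<lambda>y. f' y u) has_derivative fu y) (at y)"
    and fv: "\<And>y. y \<in> S \<Longrightarrow> ((\<lambda>y. f' y v) has_derivative fv y) (at y)"
    and cu: "continuous_on S (\<lambda>y. fu y v)" and cv: "continuous_on S (\<lambda>y. fv y u)"
  shows "fu x v = fv x u"
proof (rule ccontr)
  assume ne: "fu x v \<noteq> fv x u"
  define \<epsilon> where "\<epsilon> = \<bar>fu x v - fv x u\<bar> / 2"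
  have \<epsilon>: "\<epsilon> > 0" using ne by (simp add: \<epsilon>_def)
  have "isCont (\<lambda>y. fu y v) x" "isCont (\<lambda>y. fv y u) x"
    using cu cv S by (simp_all add: continuous_on_eq_continuous_at)
  then obtain d1 d2 where d: "d1 > 0" "d2 > 0"
    "\<And>y. dist y x < d1 \<Longrightarrow> dist (fu y v) (fu x v) < \<epsilon>"
    "\<And>y. dist y x < d2 \<Longrightarrow> dist (fv y u) (fv x u) < \<epsilon>"
    using \<epsilon> unfolding continuous_at_eps_delta by metis
  obtain d3 where d3: "d3 > 0" "ball x d3 \<subseteq> S" using S open_contains_ball by blast
  define d where "d = min d1 (min d2 d3)"
  have dp: "d > 0" using d d3 by (simp add: d_def)
  \<comment> \<open>This side length keeps the parallelogram within \<open>d\<close> of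
    \<open>x\<close>; the summand 1 covers \<open>u = v = 0\<close>.\<close>
  define h where "h = d / (2 * (norm u + norm v + 1))"
  have nn: "norm u + norm v + 1 > 0" by (simp add: add_nonneg_pos)
  have hp: "h > 0" using dp nn unfolding h_def by simp
  define p where "p s t = x + s *\<^sub>R u + t *\<^sub>R v" for s t
  have near: "dist (p s t) x < d" if "0 \<le> s" "s \<le> h" "0 \<le> t" "t \<le> h" for s t
  proof -
    have "dist (p s t) x = norm (s *\<^sub>R u + t *\<^sub>R v)" by (simp add: p_def dist_norm)
    also have "\<dots> \<le> s * norm u + t * norm v" using that by (intro norm_triangle_le) simp
    also have "\<dots> \<le> h * norm u + h * norm v" using that by (intro add_mono mult_right_mono) auto
    also have "\<dots> \<le> h * (norm u + norm v + 1)" using hp by (simp add: algebra_simps)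
    also have "\<dots> = d / 2" using nn unfolding h_def by (auto simp: divide_simps)
    finally show ?thesis using dp by simp
  qed
  have pS: "p s t \<in> S" if "0 \<le> s" "s \<le> h" "0 \<le> t" "t \<le> h" for s t
    using near[OF that] d3 by (auto simp: d_def dist_commute subset_iff)
  have ps: "((\<lambda>s. p s t) has_derivative (\<lambda>k. k *\<^sub>R u)) (at s)" for s t
    unfolding p_def by (auto intro!: derivative_eq_intros)
  have pt: "(p s has_derivative (\<lambda>k. k *\<^sub>R v)) (at t)" for s t
    unfolding p_def by (auto intro!: derivative_eq_intros)
  have chain: "((\<lambda>s. g (c s)) has_real_derivative g' w) (at s)"
    if "(c has_derivative (\<lambda>k. k *\<^sub>R w)) (at s)" "(g has_derivative g') (at (c s))"
    for g g' c w and s :: real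
  proof -
    have "((\<lambda>s. g (c s)) has_derivative (\<lambda>k. g' (k *\<^sub>R w))) (at s)"
      using has_derivative_compose[OF that] .
    moreover have "(\<lambda>k. g' (k *\<^sub>R w)) = (*) (g' w)"
      using linear_cmul[OF has_derivative_linear[OF that(2)]] by (auto simp: mult.commute)
    ultimately show ?thesis by (simp add: has_field_derivative_def)
  qed
  obtain s t where st: "0 < s" "s < h" "0 < t" "t < h"
    "f (p h h) - f (p h 0) - f (p 0 h) + f (p 0 0) = h\<^sup>2 * fu (p s t) v"
  proof (rule mixed_difference_mean_value[OF hp, of "\<lambda>s t. f (p s t)" "\<lambda>s t. f' (p s t) u" "\<lambda>s t. fu (p s t) v"])
  qed (use pS in \<open>auto intro!: chain[OF ps f] chain[OF pt fu]\<close>)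
  obtain t' s' where st': "0 < t'" "t' < h" "0 < s'" "s' < h"
    "f (p h h) - f (p 0 h) - f (p h 0) + f (p 0 0) = h\<^sup>2 * fv (p s' t') u"
  proof (rule mixed_difference_mean_value[OF hp, of "\<lambda>t s. f (p s t)" "\<lambda>t s. f' (p s t) v" "\<lambda>t s. fv (p s t) u"])
  qed (use pS in \<open>auto intro!: chain[OF pt f] chain[OF ps fv]\<close>)
  have "h\<^sup>2 * fu (p s t) v = h\<^sup>2 * fv (p s' t') u" using st(5) st'(5) by linarith
  then have "fu (p s t) v = fv (p s' t') u" using hp by simp
  moreover have "dist (fu (p s t) v) (fu x v) < \<epsilon>" "dist (fv (p s' t') u) (fv x u) < \<epsilon>"
    using near[of s t] near[of s' t'] st st' by (auto intro!: d simp: d_def)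
  ultimately show False unfolding \<epsilon>_def dist_real_def by (smt (verit) field_sum_of_halves)
qed

lemma continuous_second_derivatives_symmetric:
  fixes f :: "'a::real_normed_vector \<Rightarrow> 'b::real_inner"
  assumes S: "open S" "x \<in> S"
    and f: "\<And>y. y \<in> S \<Longrightarrow> (f has_derivative f' y) (at y)"
    and fu: "\<And>y. y \<in> S \<Longrightarrow> ((\<lambda>y. f' y u) has_derivative fu y) (at y)"
    and fv: "\<And>y. y \<in> S \<Longrightarrow> ((\<lambda>y. f' y v) has_derivative fv y) (at y)"
    and cu: "continuous_on S (\<lambda>y. fu y v)" and cv: "continuous_on S (\<lambda>y. fv y u)"
  shows "fu x v = fv x u"
proof -
  have "fu x v \<bullet> c = fv x u \<bullet> c" for c
    by (rule continuous_second_derivatives_symmetric_real[OF S, of "\<lambda>y. f y \<bullet> c" "\<lambda>y z. f' y z \<bullet> c"])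
      (intro has_derivative_inner_left f fu fv continuous_intros cu cv; assumption)+
  then show ?thesis using vector_eq_rdot by blast
qed

subsection \<open>Smooth maps and the geometry of graphs\<close>

lemma Ck_on_cong:
  assumes "open S" "\<And>x. x \<in> S \<Longrightarrow> f x = g x" "Ck_on k S f"
  shows "Ck_on k S g"
  using assms(2,3)
proof (induction k arbitrary: f g)
  case 0
  then show ?case by (simp cong: continuous_on_cong)
next
  case (Suc k)
  have f: "f differentiable at x" if "x \<in> S" for x
    using Suc.prems(2) that by (simp add: differentiable_on_eq_differentiable_at[OF assms(1)])
  have eq: "frechet_derivative f (at x) = frechet_derivative g (at x)" if "x \<in> S" for x
    using f[OF that] assms(1) that Suc.prems(1) by (rule frechet_derivative_transform_within_open)
  have "g differentiable_on S"
    using f Suc.prems(1) unfolding differentiable_on_eq_differentiable_at[OF assms(1)] differentiable_def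
    by (meson assms(1) has_derivative_transform_within_open)
  moreover have "Ck_on k S (\<lambda>x. frechet_derivative g (at x) v)" for v
    by (rule Suc.IH[of "\<lambda>x. frechet_derivative f (at x) v"]) (use eq Suc.prems in auto)
  ultimately show ?case by simp
qed

lemma Ck_on_const: "Ck_on k S (\<lambda>x. c)"
  by (induction k arbitrary: c) auto

lemma Ck_on_affine:
  assumes "bounded_linear L"
  shows "Ck_on k S (\<lambda>x. c + L x)"
proof (cases k)
  case 0
  show ?thesis unfolding 0 Ck_on.simps
    by (intro continuous_on_add continuous_on_const linear_continuous_on assms)
next
  case (Suc j)
  have d: "((\<lambda>x. c + L x) has_derivative L) F" for F
    using has_derivative_add[OF has_derivative_const bounded_linear.has_derivative[OF assms has_derivative_ident]]
    by simp
  have "frechet_derivative (\<lambda>x. c + L x) (at x) = L" for x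
    using frechet_derivative_at[OF d] by simp
  moreover have "(\<lambda>x. c + L x) differentiable_on S"
    using d unfolding differentiable_on_def differentiable_def by blast
  ultimately show ?thesis by (simp add: Suc Ck_on_const)
qed

lemma Ck_on_Pair:
  assumes S: "open S" and "Ck_on k S f" "Ck_on k S g"
  shows "Ck_on k S (\<lambda>x. (f x, g x))"
  using assms(2,3)
proof (induction k arbitrary: f g)
  case 0
  then show ?case by (simp add: continuous_on_Pair)
next
  case (Suc k)
  have fg: "((\<lambda>x. (f x, g x)) has_derivative
      (\<lambda>v. (frechet_derivative f (at x) v, frechet_derivative g (at x) v))) (at x)" if "x \<in> S" for x
    using Suc.prems that
    by (intro has_derivative_Pair) (auto simp: differentiable_on_eq_differentiable_at[OF S] frechet_derivative_works)
  have "Ck_on k S (\<lambda>x. frechet_derivative (\<lambda>x. (f x, g x)) (at x) v)" for v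
  proof (rule Ck_on_cong[OF S])
    show "Ck_on k S (\<lambda>x. (frechet_derivative f (at x) v, frechet_derivative g (at x) v))"
      using Suc by simp
  qed (simp add: frechet_derivative_at[OF fg, symmetric])
  moreover have "(\<lambda>x. (f x, g x)) differentiable_on S"
    using fg by (auto simp: differentiable_on_eq_differentiable_at[OF S] differentiable_def)
  ultimately show ?case by simp
qed

text \<open>For an affine inner map, the derivative in direction \<open>v\<close> is a directional
  derivative of \<open>f\<close> along the fixed vector \<open>L v\<close>, composed with the same
  map. So the induction closes without a product rule. The uses are lines in the domain and the
  projection \<open>fst\<close>.\<close>

lemma Ck_on_compose_affine:
  assumes S: "open S" and T: "open T" and L: "bounded_linear L" and sub: "\<And>x. x \<in> T \<Longrightarrow> c + L x \<in> S"
    and "Ck_on k S f"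
  shows "Ck_on k T (\<lambda>x. f (c + L x))"
  using assms(5)
proof (induction k arbitrary: f)
  case 0
  then have "continuous_on S f" by simp
  moreover have "continuous_on T (\<lambda>x. c + L x)"
    by (intro continuous_on_add continuous_on_const linear_continuous_on L)
  ultimately have "continuous_on T (\<lambda>x. f (c + L x))"
    by (rule continuous_on_compose2) (use sub in auto)
  then show ?case by simp
next
  case (Suc k)
  have dL: "((\<lambda>x. c + L x) has_derivative L) F" for F
    using has_derivative_add[OF has_derivative_const bounded_linear.has_derivative[OF L has_derivative_ident]]
    by simp
  have d: "((\<lambda>x. f (c + L x)) has_derivative (\<lambda>v. frechet_derivative f (at (c + L x)) (L v))) (at x)"
    if "x \<in> T" for x
    using Suc.prems sub[OF that]
    by (intro has_derivative_compose[OF dL])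
      (auto simp: differentiable_on_eq_differentiable_at[OF S] frechet_derivative_works)
  have "Ck_on k T (\<lambda>x. frechet_derivative (\<lambda>x. f (c + L x)) (at x) v)" for v
  proof (rule Ck_on_cong[OF T])
    show "Ck_on k T (\<lambda>x. frechet_derivative f (at (c + L x)) (L v))"
      using Suc.IH[of "\<lambda>y. frechet_derivative f (at y) (L v)"] Suc.prems by simp
  qed (simp add: frechet_derivative_at[OF d, symmetric])
  moreover have "(\<lambda>x. f (c + L x)) differentiable_on T"
    using d by (auto simp: differentiable_on_eq_differentiable_at[OF T] differentiable_def)
  ultimately show ?case by simp
qed

lemma has_derivative_frechet_on:
  assumes "open S" "Ck_on (Suc k) S g" "x \<in> S"
  shows "(g has_derivative frechet_derivative g (at x)) (at x)"
  using assms by (auto simp: differentiable_on_eq_differentiable_at frechet_derivative_works)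

lemma Ck_on_second_derivative_symmetric:
  fixes g :: "'a::real_normed_vector \<Rightarrow> 'b::real_inner"
  assumes S: "open S" and x: "x \<in> S" and g: "Ck_on (Suc (Suc k)) S g"
  shows "frechet_derivative (\<lambda>y. frechet_derivative g (at y) v) (at x) u =
         frechet_derivative (\<lambda>y. frechet_derivative g (at y) u) (at x) v"
proof -
  have g1: "Ck_on (Suc k) S (\<lambda>y. frechet_derivative g (at y) w)" for w using g by simp
  have "Ck_on k S (\<lambda>x. frechet_derivative (\<lambda>y. frechet_derivative g (at y) w) (at x) z)" for w z
    using g1 by simp
  then have "continuous_on S (\<lambda>x. frechet_derivative (\<lambda>y. frechet_derivative g (at y) w) (at x) z)" for w z
    by (cases k) (auto intro: differentiable_imp_continuous_on)
  then show ?thesis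
    by (intro continuous_second_derivatives_symmetric[OF S x, of g "\<lambda>y. frechet_derivative g (at y)"]
        has_derivative_frechet_on[OF S g] has_derivative_frechet_on[OF S g1])
qed

text \<open>A product rule for a varying operator applied to a varying vector, when only the maps
  \<open>\<lambda>y. A y v\<close> with fixed \<open>v\<close> are known to be differentiable:
  expand \<open>w y\<close> in the basis.\<close>

lemma has_derivative_linear_apply:
  fixes A :: "'a::real_normed_vector \<Rightarrow> 'b::euclidean_space \<Rightarrow> 'c::real_normed_vector"
  assumes D: "open D" "x \<in> D" and A: "\<And>y. y \<in> D \<Longrightarrow> linear (A y)"
    and q: "\<And>v. ((\<lambda>y. A y v) has_derivative (\<lambda>u. q u v)) (at x)" and lq: "\<And>u. linear (q u)"
    and w: "(w has_derivative w') (at x)"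
  shows "((\<lambda>y. A y (w y)) has_derivative (\<lambda>u. A x (w' u) + q u (w x))) (at x)"
proof -
  have expand: "(\<Sum>b\<in>Basis. (z \<bullet> b) *\<^sub>R F b) = F z" if "linear F" for F :: "'b \<Rightarrow> 'c" and z
  proof -
    have "F z = F (\<Sum>b\<in>Basis. (z \<bullet> b) *\<^sub>R b)" by (simp add: euclidean_representation)
    then show ?thesis by (simp add: linear_sum[OF that] linear_cmul[OF that])
  qed
  have "((\<lambda>y. \<Sum>b\<in>Basis. (w y \<bullet> b) *\<^sub>R A y b) has_derivative
      (\<lambda>u. \<Sum>b\<in>Basis. (w x \<bullet> b) *\<^sub>R q u b + (w' u \<bullet> b) *\<^sub>R A x b)) (at x)"
    by (intro has_derivative_sum has_derivative_scaleR has_derivative_inner_left w q)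
  then have "((\<lambda>y. \<Sum>b\<in>Basis. (w y \<bullet> b) *\<^sub>R A y b) has_derivative (\<lambda>u. A x (w' u) + q u (w x))) (at x)"
    by (simp add: sum.distrib expand[OF lq] expand[OF A[OF D(2)]] add.commute)
  then show ?thesis
    by (rule has_derivative_transform_within_open[OF _ D]) (rule expand[OF A])
qed

lemma orthonormal_basis_SOME:
  fixes V :: "'e::euclidean_space set"
  assumes "subspace V"
  shows "orthonormal_basis V (SOME E. orthonormal_basis V E)"
proof -
  obtain B where "pairwise orthogonal B" "\<And>x. x \<in> B \<Longrightarrow> norm x = 1" "span B = V"
    using orthonormal_basis_subspace[OF assms] by metis
  then have "orthonormal_basis V B" by (simp add: orthonormal_basis_def)
  then show ?thesis by (rule someI)
qed

lemma orthonormal_basis_finite: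
  fixes V :: "'e::euclidean_space set"
  assumes "orthonormal_basis V E"
  shows "finite E"
proof -
  have "0 \<notin> E" using assms by (auto simp: orthonormal_basis_def)
  then show ?thesis
    using assms pairwise_orthogonal_independent independent_imp_finite
    unfolding orthonormal_basis_def by blast
qed

section \<open>Tangent space, normal space and second fundamental form of a graph\<close>

locale smooth_graph =
  fixes D :: "'a::euclidean_space set" and f :: "'a \<Rightarrow> 'b::euclidean_space"
  assumes D: "open D" and smooth: "smooth_on D f"
begin

abbreviation M :: "('a \<times> 'b) set" where "M \<equiv> {(x, f x) | x. x \<in> D}"
abbreviation A :: "'a \<Rightarrow> 'a \<Rightarrow> 'b" where "A x \<equiv> frechet_derivative f (at x)"
text \<open>\<open>q\<close> and \<open>r\<close> are the second and third derivatives of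
  \<open>f\<close>; the direction differentiated last comes first.\<close>

definition q :: "'a \<Rightarrow> 'a \<Rightarrow> 'a \<Rightarrow> 'b" where "q x u v = frechet_derivative (\<lambda>y. A y v) (at x) u"
definition r :: "'a \<Rightarrow> 'a \<Rightarrow> 'a \<Rightarrow> 'a \<Rightarrow> 'b" where "r x w u v = frechet_derivative (\<lambda>y. q y u v) (at x) w"

lemma Ck: "Ck_on k D f" "Ck_on k D (\<lambda>y. A y v)" "Ck_on k D (\<lambda>y. q y u v)"
proof -
  have c: "Ck_on j D f" for j using smooth by (simp add: smooth_on_def)
  from c show "Ck_on k D f" .
  from c[of "Suc k"] show "Ck_on k D (\<lambda>y. A y v)" by simp
  from c[of "Suc (Suc k)"] show "Ck_on k D (\<lambda>y. q y u v)" by (simp add: q_def)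
qed

lemma deriv_f: "x \<in> D \<Longrightarrow> (f has_derivative A x) (at x)"
  using has_derivative_frechet_on[OF D Ck(1)] .

lemma deriv_A: "x \<in> D \<Longrightarrow> ((\<lambda>y. A y v) has_derivative (\<lambda>u. q x u v)) (at x)"
  using has_derivative_frechet_on[OF D Ck(2)] by (simp add: q_def[abs_def])

lemma deriv_q: "x \<in> D \<Longrightarrow> ((\<lambda>y. q y u v) has_derivative (\<lambda>w. r x w u v)) (at x)"
  using has_derivative_frechet_on[OF D Ck(3)] by (simp add: r_def[abs_def])

lemma linear_A: "x \<in> D \<Longrightarrow> linear (A x)"
  using deriv_f has_derivative_linear by blast

lemma q_sym: "x \<in> D \<Longrightarrow> q x u v = q x v u"
  unfolding q_def using Ck_on_second_derivative_symmetric[OF D _ Ck(1)] .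

lemma linear_q1: "x \<in> D \<Longrightarrow> linear (\<lambda>u. q x u v)"
  using deriv_A has_derivative_linear by blast

lemma linear_q2: "x \<in> D \<Longrightarrow> linear (q x u)"
  using linear_q1[of x u] q_sym[of x u] by (simp add: linear_iff)

text \<open>The first identity differentiates the symmetry of \<open>q\<close>; the second is
  symmetry of second derivatives for \<open>\<lambda>y. A y v\<close>. Together they make
  \<open>r\<close> totally symmetric.\<close>

lemma r_sym:
  assumes "x \<in> D"
  shows "r x w u v = r x w v u" "r x w u v = r x u w v"
proof -
  have "((\<lambda>y. q y v u) has_derivative (\<lambda>w. r x w u v)) (at x)"
    by (rule has_derivative_transform_within_open[OF deriv_q D]) (use assms q_sym in auto)
  then show "r x w u v = r x w v u"
    using has_derivative_unique[OF _ deriv_q[OF assms]] by metis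
  show "r x w u v = r x u w v"
    unfolding q_def r_def using Ck_on_second_derivative_symmetric[OF D assms Ck(2)] .
qed

text \<open>A curve in the graph satisfies \<open>snd (\<gamma> t) = f (fst (\<gamma> t))\<close>,
  and differentiating at 0 gives one inclusion. Conversely, lift the line
  \<open>x + t *\<^sub>R v\<close> to the graph.\<close>

lemma tangent_space_graph:
  assumes x: "x \<in> D"
  shows "tangent_space M (x, f x) = range (\<lambda>v. (v, A x v))"
proof
  show "tangent_space M (x, f x) \<subseteq> range (\<lambda>v. (v, A x v))"
  proof
    fix z assume "z \<in> tangent_space M (x, f x)"
    then obtain \<gamma> \<epsilon> where z: "z = vector_derivative \<gamma> (at 0)" and \<epsilon>: "0 < \<epsilon>"
      and sm: "smooth_on {-\<epsilon><..<\<epsilon>} \<gamma>" and im: "\<gamma> ` {-\<epsilon><..<\<epsilon>} \<subseteq> M" and \<gamma>0: "\<gamma> 0 = (x, f x)"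
      unfolding tangent_space_def by blast
    have "Ck_on (Suc 0) {-\<epsilon><..<\<epsilon>} \<gamma>" using sm unfolding smooth_on_def by blast
    then have "\<gamma> differentiable at 0"
      using \<epsilon> by (simp add: differentiable_on_eq_differentiable_at)
    then have "(\<gamma> has_derivative (\<lambda>t. t *\<^sub>R z)) (at 0)"
      unfolding z using vector_derivative_works has_vector_derivative_def by blast
    then have d1: "((\<lambda>t. fst (\<gamma> t)) has_derivative (\<lambda>t. t *\<^sub>R fst z)) (at 0)"
      and d2: "((\<lambda>t. snd (\<gamma> t)) has_derivative (\<lambda>t. t *\<^sub>R snd z)) (at 0)"
      by (auto dest: has_derivative_fst has_derivative_snd)
    have "((\<lambda>t. f (fst (\<gamma> t))) has_derivative (\<lambda>t. A x (t *\<^sub>R fst z))) (at 0)"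
      by (rule has_derivative_compose[OF d1]) (simp add: \<gamma>0 deriv_f x)
    then have "((\<lambda>t. snd (\<gamma> t)) has_derivative (\<lambda>t. A x (t *\<^sub>R fst z))) (at 0)"
    proof (rule has_derivative_transform_within_open)
      show "open {-\<epsilon><..<\<epsilon>}" "0 \<in> {-\<epsilon><..<\<epsilon>}" using \<epsilon> by auto
      show "f (fst (\<gamma> t)) = snd (\<gamma> t)" if "t \<in> {-\<epsilon><..<\<epsilon>}" for t
      proof -
        have "\<gamma> t \<in> M" using im that by blast
        then show ?thesis by auto
      qed
    qed
    from has_derivative_unique[OF this d2] have "A x (1 *\<^sub>R fst z) = 1 *\<^sub>R snd z" by metis
    then have "z = (fst z, A x (fst z))" by (simp add: prod_eq_iff)
    then show "z \<in> range (\<lambda>v. (v, A x v))" by blast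
  qed
next
  show "range (\<lambda>v. (v, A x v)) \<subseteq> tangent_space M (x, f x)"
  proof clarify
    fix v
    have "open ((\<lambda>t. x + t *\<^sub>R v) -` D)"
      by (rule open_vimage[OF D]) (intro continuous_intros)
    moreover have "0 \<in> (\<lambda>t. x + t *\<^sub>R v) -` D" using x by simp
    ultimately obtain \<epsilon> where \<epsilon>: "\<epsilon> > 0" "ball 0 \<epsilon> \<subseteq> (\<lambda>t. x + t *\<^sub>R v) -` D"
      using open_contains_ball by metis
    have I: "{-\<epsilon><..<\<epsilon>} = ball 0 \<epsilon>" by (auto simp: dist_real_def)
    define \<gamma> where "\<gamma> t = (x + t *\<^sub>R v, f (x + t *\<^sub>R v))" for t
    have bl: "bounded_linear (\<lambda>t. t *\<^sub>R v)" by (rule bounded_linear_scaleR_left)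
    have "smooth_on {-\<epsilon><..<\<epsilon>} \<gamma>"
      unfolding smooth_on_def \<gamma>_def
    proof (intro allI Ck_on_Pair Ck_on_affine bl Ck_on_compose_affine[OF D _ bl _ Ck(1)])
      show "x + t *\<^sub>R v \<in> D" if "t \<in> {-\<epsilon><..<\<epsilon>}" for t using \<epsilon> that I by auto
    qed auto
    moreover have "\<gamma> ` {-\<epsilon><..<\<epsilon>} \<subseteq> M" using \<epsilon> I by (auto simp: \<gamma>_def)
    moreover have "vector_derivative \<gamma> (at 0) = (v, A x v)"
    proof (rule vector_derivative_at)
      have d: "((\<lambda>t. x + t *\<^sub>R v) has_derivative (\<lambda>t. t *\<^sub>R v)) (at 0)"
        by (auto intro!: derivative_eq_intros)
      have "(\<gamma> has_derivative (\<lambda>t. (t *\<^sub>R v, A x (t *\<^sub>R v)))) (at 0)"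
        unfolding \<gamma>_def by (intro has_derivative_Pair d has_derivative_compose[OF d]) (simp add: deriv_f x)
      then show "(\<gamma> has_vector_derivative (v, A x v)) (at 0)"
        unfolding has_vector_derivative_def by (simp add: linear_cmul[OF linear_A[OF x]])
    qed
    moreover have "\<gamma> 0 = (x, f x)" by (simp add: \<gamma>_def)
    ultimately show "(v, A x v) \<in> tangent_space M (x, f x)"
      unfolding tangent_space_def mem_Collect_eq using \<epsilon>(1) by (intro exI[of _ \<gamma>] exI[of _ \<epsilon>]) simp
  qed
qed

lemma subspace_tangent_space: "x \<in> D \<Longrightarrow> subspace (tangent_space M (x, f x))"
  unfolding tangent_space_graph
  by (intro linear_subspace_image subspace_UNIV)
    (auto simp: linear_iff linear_add[OF linear_A] linear_cmul[OF linear_A])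

lemma normal_space_graph:
  assumes x: "x \<in> D"
  shows "normal_space M (x, f x) = range (\<lambda>w. (- adjoint (A x) w, w))"
proof -
  have "(z, w) \<in> normal_space M (x, f x) \<longleftrightarrow> z = - adjoint (A x) w" for z w
  proof -
    have "(z, w) \<in> normal_space M (x, f x) \<longleftrightarrow> (\<forall>v. v \<bullet> (z + adjoint (A x) w) = 0)"
      unfolding normal_space_def tangent_space_graph[OF x] orthogonal_comp_def orthogonal_def
      by (auto simp: inner_simps adjoint_works[OF linear_A[OF x]])
    also have "\<dots> \<longleftrightarrow> z + adjoint (A x) w = 0" using inner_eq_zero_iff by (metis inner_zero_right)
    finally show ?thesis by (simp add: eq_neg_iff_add_eq_0)
  qed
  then show ?thesis by auto
qed

lemma subspace_normal_space: "subspace (normal_space M p)"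
  unfolding normal_space_def by (rule subspace_orthogonal_comp)

lemma normal_space_comp: "x \<in> D \<Longrightarrow> (normal_space M (x, f x))\<^sup>\<bottom> = tangent_space M (x, f x)"
  unfolding normal_space_def by (rule orthogonal_comp_self[OF subspace_tangent_space])

text \<open>Every tangent extension \<open>W\<close> obeys \<open>snd W = A (fst W)\<close> along
  the graph. Differentiating this shows that the derivative of \<open>W\<close> along
  \<open>(u, A x u)\<close> is \<open>(0, q x u v)\<close> plus a tangent vector, which the normal
  projection kills.\<close>

lemma second_fundamental_form_graph:
  assumes x: "x \<in> D"
  shows "second_fundamental_form M (x, f x) (u, A x u) (v, A x v) =
         orth_proj (normal_space M (x, f x)) (0, q x u v)"
proof -
  let ?p = "(x, f x)" and ?N = "normal_space M (x, f x)"
  define W where "W = (SOME W. tangent_extension M ?p (v, A x v) W)"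
  \<comment> \<open>The lift of the constant field \<open>v\<close>, independent of the second
    coordinate. Its existence ensures that the \<open>SOME\<close> in the definition picks a genuine
    extension.\<close>
  define V where "V = (\<lambda>z :: 'a \<times> 'b. (v, A (fst z) v))"
  have "tangent_extension M ?p (v, A x v) V"
    unfolding tangent_extension_def
  proof (intro conjI exI[of _ "D \<times> (UNIV :: 'b set)"] ballI)
    have bl: "bounded_linear (fst :: 'a \<times> 'b \<Rightarrow> 'a)" by (rule bounded_linear_fst)
    have "Ck_on k (D \<times> (UNIV :: 'b set)) (\<lambda>z. A (0 + fst z) v)" for k
      by (rule Ck_on_compose_affine[OF D _ bl _ Ck(2)]) (auto intro: open_Times D)
    then show "smooth_on (D \<times> (UNIV :: 'b set)) V"
      unfolding smooth_on_def V_def by (intro allI Ck_on_Pair Ck_on_const) (auto intro: open_Times D)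
  qed (use x D in \<open>auto intro: open_Times simp: V_def tangent_space_graph\<close>)
  then have "tangent_extension M ?p (v, A x v) W"
    unfolding W_def by (rule someI[where P = "tangent_extension M ?p (v, A x v)"])
  then obtain U where U: "open U" "?p \<in> U" "smooth_on U W" "\<And>z. z \<in> U \<inter> M \<Longrightarrow> W z \<in> tangent_space M z"
    and Wp: "W ?p = (v, A x v)"
    unfolding tangent_extension_def by blast
  define W' where "W' = frechet_derivative W (at ?p)"
  have "Ck_on (Suc 0) U W" using U(3) unfolding smooth_on_def by blast
  then have dW: "(W has_derivative W') (at ?p)"
    unfolding W'_def using U by (intro has_derivative_frechet_on)
  have dg: "((\<lambda>y. (y, f y)) has_derivative (\<lambda>u. (u, A x u))) (at x)"
    by (intro has_derivative_Pair has_derivative_ident deriv_f x)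
  have dWg: "((\<lambda>y. W (y, f y)) has_derivative (\<lambda>u. W' (u, A x u))) (at x)"
    by (rule has_derivative_compose[OF dg dW])
  have U': "open ((\<lambda>y. (y, f y)) -` U \<inter> D)"
    using U(1) D continuous_open_preimage[of D "\<lambda>y. (y, f y)" U] Ck(1)[of 0]
    by (simp add: Int_commute continuous_on_Pair)
  have xU': "x \<in> (\<lambda>y. (y, f y)) -` U \<inter> D" using U(2) x by simp
  have tang: "snd (W (y, f y)) = A y (fst (W (y, f y)))" if "y \<in> (\<lambda>y. (y, f y)) -` U \<inter> D" for y
    using U(4)[of "(y, f y)"] that tangent_space_graph[of y] by auto
  have dsnd: "((\<lambda>y. snd (W (y, f y))) has_derivative (\<lambda>u. snd (W' (u, A x u)))) (at x)"
    using dWg by (rule has_derivative_snd)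
  have d1: "((\<lambda>y. A y (fst (W (y, f y)))) has_derivative (\<lambda>u. snd (W' (u, A x u)))) (at x)"
    by (rule has_derivative_transform_within_open[OF dsnd U' xU' tang])
  have d2: "((\<lambda>y. A y (fst (W (y, f y)))) has_derivative
      (\<lambda>u. A x (fst (W' (u, A x u))) + q x u (fst (W (x, f x))))) (at x)"
    by (rule has_derivative_linear_apply[OF D x linear_A deriv_A[OF x] linear_q2[OF x] has_derivative_fst[OF dWg]])
  \<comment> \<open>Two derivatives of the same function: \<open>d1\<close> comes from tangency of
    \<open>W\<close>, \<open>d2\<close> from the product rule.\<close>
  have "snd (W' (u, A x u)) = A x (fst (W' (u, A x u))) + q x u (fst (W (x, f x)))"
    using fun_cong[OF has_derivative_unique[OF d1 d2]] .
  then obtain w where w: "W' (u, A x u) = (w, A x w) + (0, q x u v)"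
    using Wp by (metis add.right_neutral add_Pair fst_conv prod.collapse)
  define y where "y = orth_proj ?N (0, q x u v)"
  have y: "y \<in> ?N" "(0, q x u v) - y \<in> ?N\<^sup>\<bottom>"
    using orth_proj_unique[OF subspace_normal_space, of ?p "(0, q x u v)" y] y_def by auto
  have "(w, A x w) \<in> ?N\<^sup>\<bottom>" unfolding normal_space_comp[OF x] tangent_space_graph[OF x] by blast
  then have "(w, A x w) + ((0, q x u v) - y) \<in> ?N\<^sup>\<bottom>"
    using y(2) subspace_orthogonal_comp subspace_add by blast
  then have "W' (u, A x u) - y \<in> ?N\<^sup>\<bottom>" unfolding w by (simp only: add_diff_eq)
  with y(1) have "orth_proj ?N (W' (u, A x u)) = y"
    using orth_proj_unique[OF subspace_normal_space] by blast
  then show ?thesis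
    unfolding second_fundamental_form_def W_def[symmetric] W'_def[symmetric] Let_def y_def .
qed

text \<open>The mean curvature is the normal projection of the vertical vector
  \<open>(0, \<Sum>e\<in>E. q x (fst e) (fst e))\<close>. If it vanishes, this vector is tangent,
  and a vertical tangent vector of a graph is zero.\<close>

lemma minimal_graph_equation:
  assumes x: "x \<in> D" and "mean_curvature M (x, f x) = 0"
  obtains E where "orthonormal_basis (range (\<lambda>v. (v, A x v))) E" "(\<Sum>e\<in>E. q x (fst e) (fst e)) = 0"
proof -
  let ?T = "tangent_space M (x, f x)" and ?N = "normal_space M (x, f x)"
  define E where "E = (SOME E. orthonormal_basis ?T E)"
  have E: "orthonormal_basis ?T E"
    unfolding E_def by (rule orthonormal_basis_SOME[OF subspace_tangent_space[OF x]])
  let ?b = "\<lambda>e. (0, q x (fst e) (fst e))"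
  have sff: "second_fundamental_form M (x, f x) e e = orth_proj ?N (?b e)" if "e \<in> E" for e
  proof -
    have "e \<in> ?T" using E that span_superset unfolding orthonormal_basis_def by blast
    then obtain v where "e = (v, A x v)" unfolding tangent_space_graph[OF x] by blast
    then show ?thesis using second_fundamental_form_graph[OF x] by simp
  qed
  have "mean_curvature M (x, f x) = (\<Sum>e\<in>E. orth_proj ?N (?b e))"
    unfolding mean_curvature_def E_def[symmetric] using sff by simp
  with assms(2) have "(\<Sum>e\<in>E. orth_proj ?N (?b e)) = 0" by simp
  moreover have "?b e - orth_proj ?N (?b e) \<in> ?T" for e
    using orth_proj_unique[OF subspace_normal_space, of "(x, f x)" "?b e" "orth_proj ?N (?b e)"]
    unfolding normal_space_comp[OF x] by simp
  then have "(\<Sum>e\<in>E. ?b e - orth_proj ?N (?b e)) \<in> ?T"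
    by (intro subspace_sum subspace_tangent_space x)
  ultimately have "(\<Sum>e\<in>E. ?b e) \<in> ?T" by (simp add: sum_subtractf)
  then have "(0, \<Sum>e\<in>E. q x (fst e) (fst e)) \<in> range (\<lambda>v. (v, A x v))"
    by (simp add: sum_prod tangent_space_graph[OF x])
  then have "(\<Sum>e\<in>E. q x (fst e) (fst e)) = 0"
    using linear_0[OF linear_A[OF x]] by auto
  with E show ?thesis using that tangent_space_graph[OF x] by simp
qed

end

subsection \<open>Jordan angles of a graph\<close>

lemma eigenvalues_gram_nonneg:
  fixes A :: "'a::euclidean_space \<Rightarrow> 'b::euclidean_space"
  assumes A: "linear A" and "\<mu> \<in> eigenvalues (\<lambda>u. adjoint A (A u))"
  shows "\<mu> \<ge> 0"
proof -
  obtain u where u: "u \<noteq> 0" "adjoint A (A u) = \<mu> *\<^sub>R u" using assms(2) by (auto simp: eigenvalues_def)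
  have "\<mu> * (u \<bullet> u) = A u \<bullet> A u"
    using adjoint_works[OF A, of u "A u"] u(2) by simp
  then have "0 \<le> \<mu> * (u \<bullet> u)" by simp
  moreover have "u \<bullet> u > 0" using u(1) by simp
  ultimately show ?thesis by (simp add: zero_le_mult_iff)
qed

text \<open>If \<open>u\<close> is an eigenvector for \<open>\<mu> \<noteq> 0\<close>, then
  \<open>A u\<close> is one for the product in the other order, nonzero since
  \<open>adjoint A (A u)\<close> is.\<close>

lemma eigenvalues_gram_transfer:
  fixes A :: "'a::euclidean_space \<Rightarrow> 'b::euclidean_space"
  assumes A: "linear A"
  shows "eigenvalues (\<lambda>u. adjoint A (A u)) - {0} \<subseteq> eigenvalues (\<lambda>w. A (adjoint A w))"
proof
  fix \<mu> assume "\<mu> \<in> eigenvalues (\<lambda>u. adjoint A (A u)) - {0}"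
  then obtain u where u: "u \<noteq> 0" "adjoint A (A u) = \<mu> *\<^sub>R u" and \<mu>: "\<mu> \<noteq> 0"
    by (auto simp: eigenvalues_def)
  have "A (adjoint A (A u)) = \<mu> *\<^sub>R A u" using u(2) by (simp add: linear_cmul[OF A])
  moreover have "A u \<noteq> 0"
  proof
    assume "A u = 0"
    then have "adjoint A (A u) = 0" using linear_0[OF adjoint_linear[OF A]] by simp
    with u \<mu> show False by simp
  qed
  ultimately show "\<mu> \<in> eigenvalues (\<lambda>w. A (adjoint A w))" unfolding eigenvalues_def by blast
qed

text \<open>Dividing by the squared cosine gives
  \<open>k w = (tan \<theta>)\<^sup>2 *\<^sub>R w\<close>. The angle \<open>pi / 2\<close> cannot
  occur, because there the equation reads \<open>w = 0\<close>.\<close>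

lemma angles_eigenvalues:
  assumes "\<And>\<mu>. \<mu> \<in> eigenvalues k \<Longrightarrow> \<mu> \<ge> 0"
  shows "{\<theta>. 0 \<le> \<theta> \<and> \<theta> \<le> pi / 2 \<and> (\<exists>w. w \<noteq> 0 \<and> (1 - (cos \<theta>)\<^sup>2) *\<^sub>R w = (cos \<theta>)\<^sup>2 *\<^sub>R k w)}
     = (\<lambda>\<mu>. arctan (sqrt \<mu>)) ` eigenvalues k" (is "?L = ?R")
proof (intro equalityI subsetI)
  fix \<theta> assume "\<theta> \<in> ?L"
  then obtain w where \<theta>: "0 \<le> \<theta>" "\<theta> \<le> pi / 2" and w: "w \<noteq> 0" "(1 - (cos \<theta>)\<^sup>2) *\<^sub>R w = (cos \<theta>)\<^sup>2 *\<^sub>R k w"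
    by blast
  have c: "cos \<theta> \<noteq> 0" using w by auto
  then have "\<theta> \<noteq> pi / 2" using cos_pi_half by metis
  then have \<theta>': "\<theta> < pi / 2" using \<theta> by simp
  have "k w = (1 / (cos \<theta>)\<^sup>2) *\<^sub>R ((cos \<theta>)\<^sup>2 *\<^sub>R k w)" using c by simp
  also have "\<dots> = ((1 - (cos \<theta>)\<^sup>2) / (cos \<theta>)\<^sup>2) *\<^sub>R w" unfolding w(2)[symmetric] by simp
  also have "(1 - (cos \<theta>)\<^sup>2) / (cos \<theta>)\<^sup>2 = (tan \<theta>)\<^sup>2"
    by (simp add: tan_def power_divide sin_squared_eq)
  finally have "(tan \<theta>)\<^sup>2 \<in> eigenvalues k" using w(1) unfolding eigenvalues_def by blast
  moreover have "arctan (sqrt ((tan \<theta>)\<^sup>2)) = \<theta>"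
    using \<theta> \<theta>' tan_pos_pi2_le[of \<theta>] by (simp add: arctan_tan)
  ultimately show "\<theta> \<in> ?R" by (metis image_eqI)
next
  fix \<theta> assume "\<theta> \<in> ?R"
  then obtain \<mu> w where \<theta>: "\<theta> = arctan (sqrt \<mu>)" and \<mu>: "\<mu> \<in> eigenvalues k" "w \<noteq> 0" "k w = \<mu> *\<^sub>R w"
    unfolding eigenvalues_def by blast
  have p: "\<mu> \<ge> 0" using assms \<mu>(1) by blast
  have c: "(cos \<theta>)\<^sup>2 = 1 / (1 + \<mu>)" using p by (simp add: \<theta> cos_arctan power_divide)
  have "1 - (cos \<theta>)\<^sup>2 = (cos \<theta>)\<^sup>2 * \<mu>" unfolding c using p by (simp add: field_simps)
  then have "(1 - (cos \<theta>)\<^sup>2) *\<^sub>R w = (cos \<theta>)\<^sup>2 *\<^sub>R k w" by (simp add: \<mu>(3))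
  moreover have "0 \<le> \<theta>" "\<theta> \<le> pi / 2" using p arctan_ubound[of "sqrt \<mu>"] by (simp_all add: \<theta>)
  ultimately show "\<theta> \<in> ?L" using \<mu>(2) by blast
qed

text \<open>\<open>S\<close> may be all of the reals, since \<open>sqrt\<close> is extended to
  negative numbers as an odd function and so stays injective.\<close>

lemma inj_on_arctan_sqrt: "inj_on (\<lambda>\<mu>. arctan (sqrt \<mu>)) S"
  by (rule inj_onI) (simp add: arctan_eq_iff)

lemma orth_proj_vertical: "orth_proj ({0} \<times> UNIV) (u, w) = (0, w)"
  by (subst orth_proj_unique) (auto simp: subspace_Times orthogonal_comp_def orthogonal_def)

lemma orth_proj_horizontal: "orth_proj (({0} \<times> UNIV)\<^sup>\<bottom>) (u, w) = (u, 0)"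
proof (subst orth_proj_unique)
  have eq: "({0} \<times> UNIV)\<^sup>\<bottom> = UNIV \<times> {0}"
    by (auto simp: orthogonal_comp_def orthogonal_def dest: spec[of _ "_"]) (metis inner_eq_zero_iff)
  show "(u, 0) \<in> ({0} \<times> UNIV)\<^sup>\<bottom> \<and> (u, w) - (u, 0) \<in> ({0} \<times> UNIV)\<^sup>\<bottom>\<^sup>\<bottom>"
    unfolding eq by (auto simp: orthogonal_comp_def orthogonal_def)
qed (rule subspace_orthogonal_comp)

text \<open>
  With \<open>h = A\<^sup>* A\<close> the metric of the graph of \<open>A\<close> is \<open>1 + h\<close>, and \<open>(h - a)(h - b) = 0\<close> makes
  \<open>1 + a + b - h\<close> equal to \<open>(1 + a)(1 + b)\<close> times its inverse.
\<close>

lemma sum_graph_orthonormal_basis: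
  fixes A :: "'a::euclidean_space \<Rightarrow> 'b::euclidean_space" and B :: "'a \<Rightarrow> 'a \<Rightarrow> 'c::real_vector"
  assumes A: "linear A"
    and quad: "\<And>u. adjoint A (A (adjoint A (A u))) = (a + b) *\<^sub>R adjoint A (A u) - (a * b) *\<^sub>R u"
    and B1: "\<And>y. linear (\<lambda>x. B x y)" and B2: "\<And>x. linear (B x)"
    and E: "orthonormal_basis (range (\<lambda>v. (v, A v))) E"
  shows "(\<Sum>j\<in>Basis. B j ((1 + a + b) *\<^sub>R j - adjoint A (A j))) =
         ((1 + a) * (1 + b)) *\<^sub>R (\<Sum>e\<in>E. B (fst e) (fst e))"
proof -
  let ?c = "(1 + a) * (1 + b)"
  define K where "K w = (1 + a + b) *\<^sub>R w - adjoint A (A w)" for w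
  have hK: "K w + adjoint A (A (K w)) = ?c *\<^sub>R w" for w
    by (simp add: K_def linear_add[OF A] linear_add[OF adjoint_linear[OF A]] linear_diff[OF A] linear_cmul[OF A] linear_diff[OF adjoint_linear[OF A]]
        linear_cmul[OF adjoint_linear[OF A]] quad algebra_simps)
  have K: "K w = (\<Sum>e\<in>E. (?c * (w \<bullet> fst e)) *\<^sub>R fst e)" for w
  proof -
    have "(K w, A (K w)) \<in> span E" using E by (auto simp: orthonormal_basis_def)
    then have "(\<Sum>e\<in>E. ((K w, A (K w)) \<bullet> e) *\<^sub>R e) = (K w, A (K w))"
      using E orthonormal_basis_finite[OF E]
      by (intro orthonormal_basis_expand) (auto simp: orthonormal_basis_def)
    then have "K w = fst (\<Sum>e\<in>E. ((K w, A (K w)) \<bullet> e) *\<^sub>R e)" by simp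
    also have "\<dots> = (\<Sum>e\<in>E. ((K w, A (K w)) \<bullet> e) *\<^sub>R fst e)" by (simp add: fst_sum)
    also have "\<dots> = (\<Sum>e\<in>E. (?c * (w \<bullet> fst e)) *\<^sub>R fst e)"
    proof (rule sum.cong[OF refl])
      fix e assume "e \<in> E"
      then have "e \<in> range (\<lambda>v. (v, A v))" using E span_superset unfolding orthonormal_basis_def by blast
      then obtain v where e: "e = (v, A v)" by blast
      have "(K w, A (K w)) \<bullet> e = (K w + adjoint A (A (K w))) \<bullet> v"
        using adjoint_clauses(2)[OF A, of "A (K w)" v] by (simp add: e inner_add_left)
      then show "((K w, A (K w)) \<bullet> e) *\<^sub>R fst e = (?c * (w \<bullet> fst e)) *\<^sub>R fst e"
        by (simp add: hK e)
    qed
    finally show ?thesis .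
  qed
  have "(\<Sum>j\<in>Basis. B j (K j)) = (\<Sum>j\<in>Basis. \<Sum>e\<in>E. (?c * (j \<bullet> fst e)) *\<^sub>R B j (fst e))"
    by (rule sum.cong[OF refl], subst K) (simp add: linear_sum[OF B2] linear_cmul[OF B2])
  also have "\<dots> = (\<Sum>e\<in>E. ?c *\<^sub>R (\<Sum>j\<in>Basis. (fst e \<bullet> j) *\<^sub>R B j (fst e)))"
    by (subst sum.swap) (simp add: scaleR_sum_right inner_commute)
  also have "\<dots> = (\<Sum>e\<in>E. ?c *\<^sub>R B (fst e) (fst e))"
  proof (rule sum.cong[OF refl])
    fix e
    have "B (fst e) (fst e) = B (\<Sum>j\<in>Basis. (fst e \<bullet> j) *\<^sub>R j) (fst e)"
      by (simp add: euclidean_representation)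
    then show "?c *\<^sub>R (\<Sum>j\<in>Basis. (fst e \<bullet> j) *\<^sub>R B j (fst e)) = ?c *\<^sub>R B (fst e) (fst e)"
      by (simp add: linear_sum[OF B1] linear_cmul[OF B1])
  qed
  finally show ?thesis by (simp add: K_def scaleR_sum_right)
qed

section \<open>From the Jordan angles of the graph to the eigenvalues of \<open>h\<close>\<close>

context smooth_graph
begin

abbreviation h :: "'a \<Rightarrow> 'a \<Rightarrow> 'a" where "h x u \<equiv> adjoint (A x) (A x u)"

lemma linear_h: "x \<in> D \<Longrightarrow> linear (h x)"
  using linear_compose[OF linear_A adjoint_linear[OF linear_A]] by (simp add: o_def)

lemma h_inner: "x \<in> D \<Longrightarrow> h x u \<bullet> w = A x u \<bullet> A x w"
  using adjoint_clauses(2)[OF linear_A] .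

lemma h_self_adjoint: "x \<in> D \<Longrightarrow> h x u \<bullet> w = u \<bullet> h x w"
  using h_inner[of x u w] h_inner[of x w u] by (simp add: inner_commute)

text \<open>Parametrise normal vectors by their second component \<open>w\<close>. Projecting
  vertically leaves \<open>(0, w)\<close>, and this projects back to \<open>c\<close> times the
  normal vector iff the difference is tangent, which is an equation for \<open>w\<close>
  alone.\<close>

lemma jordan_angles_normal:
  assumes x: "x \<in> D"
  shows "jordan_angles (normal_space M (x, f x)) ({0} \<times> UNIV) =
         (\<lambda>\<mu>. arctan (sqrt \<mu>)) ` eigenvalues (\<lambda>w. A x (adjoint (A x) w))"
proof -
  let ?N = "normal_space M (x, f x)" and ?A' = "adjoint (A x)"
  note N = normal_space_graph[OF x]
  have "?A' w = 0 \<and> w = 0 \<longleftrightarrow> w = 0" for w using linear_0[OF adjoint_linear[OF linear_A[OF x]]] by auto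
  moreover have "orth_proj ?N (orth_proj ({0} \<times> UNIV) (- ?A' w, w)) = c *\<^sub>R (- ?A' w, w) \<longleftrightarrow>
      (1 - c) *\<^sub>R w = c *\<^sub>R A x (?A' w)" for c w
  proof -
    have "orth_proj ?N (0, w) = c *\<^sub>R (- ?A' w, w) \<longleftrightarrow> (0, w) - c *\<^sub>R (- ?A' w, w) \<in> tangent_space M (x, f x)"
    proof -
      have "(- ?A' w, w) \<in> ?N" unfolding N by blast
      then have "c *\<^sub>R (- ?A' w, w) \<in> ?N" using subspace_normal_space subspace_scale by blast
      then show ?thesis by (simp add: orth_proj_unique[OF subspace_normal_space] normal_space_comp[OF x])
    qed
    also have "\<dots> \<longleftrightarrow> (1 - c) *\<^sub>R w = c *\<^sub>R A x (?A' w)"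
      unfolding tangent_space_graph[OF x] by (auto simp: linear_cmul[OF linear_A[OF x]] scaleR_diff_left)
    finally show ?thesis by (simp add: orth_proj_vertical)
  qed
  ultimately have "jordan_angles ?N ({0} \<times> UNIV) =
    {\<theta>. 0 \<le> \<theta> \<and> \<theta> \<le> pi / 2 \<and> (\<exists>w. w \<noteq> 0 \<and> (1 - (cos \<theta>)\<^sup>2) *\<^sub>R w = (cos \<theta>)\<^sup>2 *\<^sub>R A x (?A' w))}"
    unfolding jordan_angles_def jordan_eigenspace_def N by (auto simp: prod_eq_iff)
  also have "\<dots> = (\<lambda>\<mu>. arctan (sqrt \<mu>)) ` eigenvalues (\<lambda>w. A x (?A' w))"
    using eigenvalues_gram_nonneg[OF adjoint_linear[OF linear_A[OF x]]]
    by (intro angles_eigenvalues) (simp add: adjoint_adjoint[OF linear_A[OF x]])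
  finally show ?thesis .
qed

lemma jordan_angles_tangent:
  assumes x: "x \<in> D"
  shows "jordan_angles (tangent_space M (x, f x)) (({0} \<times> UNIV)\<^sup>\<bottom>) =
         (\<lambda>\<mu>. arctan (sqrt \<mu>)) ` eigenvalues (h x)"
proof -
  let ?T = "tangent_space M (x, f x)"
  note T = tangent_space_graph[OF x]
  have "orth_proj ?T (orth_proj (({0} \<times> UNIV)\<^sup>\<bottom>) (v, A x v)) = c *\<^sub>R (v, A x v) \<longleftrightarrow>
      (1 - c) *\<^sub>R v = c *\<^sub>R h x v" for c v
  proof -
    have "orth_proj ?T (v, 0) = c *\<^sub>R (v, A x v) \<longleftrightarrow> (v, 0) - c *\<^sub>R (v, A x v) \<in> normal_space M (x, f x)"
    proof -
      have "(v, A x v) \<in> ?T" unfolding T by blast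
      then have "c *\<^sub>R (v, A x v) \<in> ?T" using subspace_tangent_space[OF x] subspace_scale by blast
      then show ?thesis by (simp add: orth_proj_unique[OF subspace_tangent_space[OF x]] normal_space_def)
    qed
    also have "\<dots> \<longleftrightarrow> (1 - c) *\<^sub>R v = c *\<^sub>R h x v"
      unfolding normal_space_graph[OF x]
      by (auto simp: linear_cmul[OF adjoint_linear[OF linear_A[OF x]]] linear_neg[OF adjoint_linear[OF linear_A[OF x]]]
          scaleR_diff_left intro!: image_eqI[where x = "- (c *\<^sub>R A x v)"])
    finally show ?thesis by (simp add: orth_proj_horizontal)
  qed
  moreover have "v = 0 \<and> A x v = 0 \<longleftrightarrow> v = 0" for v using linear_0[OF linear_A[OF x]] by auto
  ultimately have "jordan_angles ?T (({0} \<times> UNIV)\<^sup>\<bottom>) =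
    {\<theta>. 0 \<le> \<theta> \<and> \<theta> \<le> pi / 2 \<and> (\<exists>w. w \<noteq> 0 \<and> (1 - (cos \<theta>)\<^sup>2) *\<^sub>R w = (cos \<theta>)\<^sup>2 *\<^sub>R h x w)}"
    unfolding jordan_angles_def jordan_eigenspace_def T by (auto simp: prod_eq_iff)
  also have "\<dots> = (\<lambda>\<mu>. arctan (sqrt \<mu>)) ` eigenvalues (h x)"
    using eigenvalues_gram_nonneg[OF linear_A[OF x]] by (rule angles_eigenvalues)
  finally show ?thesis .
qed

text \<open>The spectrum \<open>\<Lambda>\<close> of \<open>A A*\<close> is constant by CJA, and
  away from 0 it agrees with that of \<open>h\<close>. Two nonzero values exhaust both spectra, so 0
  is not in \<open>\<Lambda>\<close>, the adjoint is injective and \<open>A x\<close> is surjective.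
  Otherwise at most one nonzero value remains and \<open>b = 0\<close>.\<close>

lemma two_singular_values:
  assumes cja: "constant_jordan_angles M ({0} \<times> UNIV)"
    and gN: "\<And>x. x \<in> D \<Longrightarrow> gN M ({0} \<times> UNIV) (x, f x) \<le> 2"
    and gT: "\<And>x. x \<in> D \<Longrightarrow> gT M ({0} \<times> UNIV) (x, f x) \<le> 2"
    and x0: "x0 \<in> D"
  obtains a b where "a \<noteq> b" "a \<ge> 0" "b \<ge> 0"
    "\<And>x u. x \<in> D \<Longrightarrow> h x (h x u) = (a + b) *\<^sub>R h x u - (a * b) *\<^sub>R u"
    "b = 0 \<or> (\<forall>x\<in>D. surj (A x))"
proof -
  define \<Lambda> where "\<Lambda> = eigenvalues (\<lambda>w. A x0 (adjoint (A x0) w))"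
  have \<Lambda>: "eigenvalues (\<lambda>w. A x (adjoint (A x) w)) = \<Lambda>" if "x \<in> D" for x
  proof -
    have "jordan_angles (normal_space M (x, f x)) ({0} \<times> UNIV) = jordan_angles (normal_space M (x0, f x0)) ({0} \<times> UNIV)"
      using cja that x0 unfolding constant_jordan_angles_def by blast
    then show ?thesis
      unfolding jordan_angles_normal[OF that] jordan_angles_normal[OF x0] \<Lambda>_def
      by (rule inj_on_image_eq_iff[THEN iffD1, OF inj_on_arctan_sqrt[of UNIV] subset_UNIV subset_UNIV])
  qed
  have A'A: "adjoint (adjoint (A x)) = A x" if "x \<in> D" for x by (rule adjoint_adjoint[OF linear_A[OF that]])
  have "\<mu> \<ge> 0" if "\<mu> \<in> \<Lambda>" for \<mu>
    using eigenvalues_gram_nonneg[OF adjoint_linear[OF linear_A[OF x0]], of \<mu>] that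
    unfolding \<Lambda>_def A'A[OF x0] .
  note \<Lambda>0 = this
  have h\<Lambda>: "eigenvalues (h x) - {0} \<subseteq> \<Lambda>" if "x \<in> D" for x
    using eigenvalues_gram_transfer[OF linear_A[OF that]] unfolding \<Lambda>[OF that] .
  have \<Lambda>h: "\<Lambda> - {0} \<subseteq> eigenvalues (h x)" if "x \<in> D" for x
    using eigenvalues_gram_transfer[OF adjoint_linear[OF linear_A[OF that]]]
    unfolding A'A[OF that] \<Lambda>[OF that] .
  have card\<Lambda>: "card \<Lambda> \<le> 2"
    using gN[OF x0] unfolding gN_def jordan_angles_normal[OF x0] \<Lambda>_def
    by (simp add: card_image[OF inj_on_arctan_sqrt])
  have cardh: "card (eigenvalues (h x)) \<le> 2" if "x \<in> D" for x
    using gT[OF that] unfolding gT_def jordan_angles_tangent[OF that]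
    by (simp add: card_image[OF inj_on_arctan_sqrt])
  have fin\<Lambda>: "finite \<Lambda>"
    unfolding \<Lambda>_def
    by (rule finite_self_adjoint_eigenvalues) (simp add: adjoint_clauses[OF linear_A[OF x0], symmetric])
  have finh: "finite (eigenvalues (h x))" if "x \<in> D" for x
    using h_self_adjoint[OF that] by (rule finite_self_adjoint_eigenvalues)
  have quad: "h x (h x u) = (a + b) *\<^sub>R h x u - (a * b) *\<^sub>R u"
    if "x \<in> D" "eigenvalues (h x) \<subseteq> {a, b}" for x u a b
    using linear_h[OF that(1)] h_self_adjoint[OF that(1)] that(2) by (rule self_adjoint_quadratic)
  show ?thesis
  proof (cases "\<exists>a\<in>\<Lambda> - {0}. \<exists>b\<in>\<Lambda> - {0}. a \<noteq> b")
    case True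
    then obtain a b where ab: "a \<in> \<Lambda> - {0}" "b \<in> \<Lambda> - {0}" "a \<noteq> b" by blast
    have "{a, b} = \<Lambda>" using ab card\<Lambda> fin\<Lambda> by (intro card_seteq) auto
    then have "0 \<notin> \<Lambda>" using ab by auto
    have ev: "{a, b} = eigenvalues (h x)" if "x \<in> D" for x
      using ab cardh[OF that] finh[OF that] \<Lambda>h[OF that] by (intro card_seteq) auto
    have "surj (A x)" if x: "x \<in> D" for x
    proof -
      have "w = 0" if "adjoint (A x) w = 0" for w
      proof (rule ccontr)
        assume "w \<noteq> 0"
        moreover have "A x (adjoint (A x) w) = 0 *\<^sub>R w"
          using that linear_0[OF linear_A[OF x]] by simp
        ultimately have "0 \<in> eigenvalues (\<lambda>w. A x (adjoint (A x) w))"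
          unfolding eigenvalues_def by blast
        with \<Lambda>[OF x] \<open>0 \<notin> \<Lambda>\<close> show False by simp
      qed
      then have "inj (adjoint (A x))"
        unfolding linear_injective_0[OF adjoint_linear[OF linear_A[OF x]]] by blast
      then show ?thesis unfolding inj_adjoint_iff_surj[OF linear_A[OF x]] .
    qed
    moreover have "a \<ge> 0" "b \<ge> 0" using ab \<Lambda>0 by auto
    ultimately show ?thesis
      using that[OF ab(3)] quad[OF _ equalityD2[OF ev]] by metis
  next
    case False
    obtain a where a: "a > 0" "\<Lambda> - {0} \<subseteq> {a}"
    proof (cases "\<Lambda> - {0} = {}")
      case True
      \<comment> \<open>With no nonzero eigenvalue any positive \<open>a\<close> will do; 1 is a
        dummy that keeps \<open>a \<noteq> b\<close>.\<close>
      then show ?thesis using that[of 1] by auto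
    next
      case ne: False
      then obtain a where "a \<in> \<Lambda> - {0}" by blast
      moreover from this have "a > 0" using \<Lambda>0[of a] by auto
      ultimately show ?thesis using that[of a] False by blast
    qed
    have "eigenvalues (h x) \<subseteq> {a, 0}" if "x \<in> D" for x using h\<Lambda>[OF that] a(2) by blast
    then show ?thesis 
      using that[of a 0] quad[of _ a 0] a(1) by simp
  qed
qed

end

subsection \<open>Minimal graphs with two singular values\<close>

text \<open>
  In the following locale the shape of \<open>Df\<close> enters only through the quadratic equation
  \<open>(h - a)(h - b) = 0\<close> for \<open>h = (Df)\<^sup>* Df\<close>. Up to the factor \<open>a - b\<close>, the map \<open>L x b = h x - b\<close> is the
  projection onto one eigenspace and \<open>L x a\<close> the one onto the other.
\<close>

locale two_value_minimal_graph = smooth_graph D f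
  for D :: "'a::euclidean_space set" and f :: "'a \<Rightarrow> 'b::euclidean_space" +
  fixes a b :: real
  assumes ab: "a \<noteq> b" "a \<ge> 0" "b \<ge> 0"
    and quad: "\<And>x u. x \<in> D \<Longrightarrow> h x (h x u) = (a + b) *\<^sub>R h x u - (a * b) *\<^sub>R u"
    and surj_or_0: "b = 0 \<or> (\<forall>x\<in>D. surj (A x))"
    and minimal: "\<And>x. x \<in> D \<Longrightarrow> mean_curvature M (x, f x) = 0"
begin

definition L :: "'a \<Rightarrow> real \<Rightarrow> 'a \<Rightarrow> 'a" where "L x c u = h x u - c *\<^sub>R u"

text \<open>The derivative of \<open>h\<close> in direction \<open>k\<close>, given by its
  coordinates: \<open>h y u \<bullet> i = A y u \<bullet> A y i\<close> can be differentiated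
  without differentiating \<open>adjoint\<close>.\<close>

definition dh :: "'a \<Rightarrow> 'a \<Rightarrow> 'a \<Rightarrow> 'a" where
  "dh x k u = (\<Sum>i\<in>Basis. (q x k u \<bullet> A x i + A x u \<bullet> q x k i) *\<^sub>R i)"

lemma dh_inner:
  assumes x: "x \<in> D"
  shows "dh x k u \<bullet> w = q x k u \<bullet> A x w + A x u \<bullet> q x k w"
proof -
  have "q x k u \<bullet> A x w + A x u \<bullet> q x k w =
      q x k u \<bullet> A x (\<Sum>i\<in>Basis. (w \<bullet> i) *\<^sub>R i) + A x u \<bullet> q x k (\<Sum>i\<in>Basis. (w \<bullet> i) *\<^sub>R i)"
    by (simp only: euclidean_representation)
  also have "\<dots> = (\<Sum>i\<in>Basis. (w \<bullet> i) * (q x k u \<bullet> A x i)) + (\<Sum>i\<in>Basis. (w \<bullet> i) * (A x u \<bullet> q x k i))"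
    by (simp add: linear_sum[OF linear_A[OF x]] linear_cmul[OF linear_A[OF x]] inner_sum_right
        linear_sum[OF linear_q2[OF x]] linear_cmul[OF linear_q2[OF x]])
  also have "\<dots> = dh x k u \<bullet> w"
    by (simp add: dh_def inner_sum_left sum.distrib[symmetric] inner_commute[of w] algebra_simps)
  finally show ?thesis by simp
qed

lemma deriv_h:
  assumes x: "x \<in> D"
  shows "((\<lambda>y. h y u) has_derivative (\<lambda>k. dh x k u)) (at x)"
proof -
  have "((\<lambda>y. \<Sum>i\<in>Basis. (A y u \<bullet> A y i) *\<^sub>R i) has_derivative
      (\<lambda>k. \<Sum>i\<in>Basis. (A x u \<bullet> q x k i + q x k u \<bullet> A x i) *\<^sub>R i)) (at x)"
    by (intro has_derivative_sum has_derivative_scaleR_left has_derivative_inner deriv_A x)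
  then have "((\<lambda>y. \<Sum>i\<in>Basis. (A y u \<bullet> A y i) *\<^sub>R i) has_derivative (\<lambda>k. dh x k u)) (at x)"
    by (simp add: dh_def[abs_def] add.commute)
  then show ?thesis
  proof (rule has_derivative_transform_within_open[OF _ D x])
    fix y assume y: "y \<in> D"
    show "(\<Sum>i\<in>Basis. (A y u \<bullet> A y i) *\<^sub>R i) = h y u"
      unfolding h_inner[OF y, symmetric] by (rule euclidean_representation)
  qed
qed

lemma linear_L: "x \<in> D \<Longrightarrow> linear (L x c)"
  unfolding L_def[abs_def] by (intro linear_compose_sub linear_h linear_compose_scale_right linear_ident)

lemma L_self_adjoint: "x \<in> D \<Longrightarrow> L x c u \<bullet> w = u \<bullet> L x c w"
  using h_self_adjoint[of x u w] by (simp add: L_def inner_diff_left inner_diff_right)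

lemma L_L:
  assumes x: "x \<in> D" and c: "{c, d} = {a, b}"
  shows "L x d (L x c u) = 0"
proof -
  have cd: "c + d = a + b" "c * d = a * b" using c by (auto simp: doubleton_eq_iff)
  have "L x d (L x c u) = h x (h x u) - ((c + d) *\<^sub>R h x u - (c * d) *\<^sub>R u)"
    by (simp add: L_def linear_diff[OF linear_h[OF x]] linear_cmul[OF linear_h[OF x]] algebra_simps)
  then show ?thesis by (simp add: quad[OF x] cd)
qed

text \<open>With \<open>d\<close> the other value, \<open>L x c\<close> maps into the
  \<open>d\<close>-eigenspace of \<open>h\<close>, on which it is multiplication by
  \<open>d - c = a + b - 2 * c\<close>.\<close>

lemma L_square:
  assumes x: "x \<in> D" and c: "c = a \<or> c = b"
  shows "L x c (L x c u) = (a + b - 2 * c) *\<^sub>R L x c u"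
proof -
  obtain d where cd: "{c, d} = {a, b}" using c by blast
  then have d: "a + b - 2 * c = d - c" by (auto simp: doubleton_eq_iff)
  have "L x c (L x c u) = L x d (L x c u) + (d - c) *\<^sub>R L x c u"
    by (simp add: L_def[of x c "L x c u"] L_def[of x d "L x c u"] scaleR_diff_left)
  then show ?thesis by (simp add: L_L[OF x cd] d)
qed

text \<open>Differentiating \<open>(h - a)(h - b) = 0\<close> and composing with the factors on both sides.\<close>

lemma skew:
  assumes x: "x \<in> D" and c: "c = a \<or> c = b"
  shows "q x k (L x c u) \<bullet> A x (L x c w) + A x (L x c u) \<bullet> q x k (L x c w) = 0"
proof -
  obtain d where cd: "{c, d} = {a, b}" using c by blast
  \<comment> \<open>The vector \<open>L x c u\<close> is frozen at \<open>x\<close>, so the term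
    that differentiates the factor \<open>L y c w\<close> meets \<open>L x d (L x c u) = 0\<close>
    and drops out.\<close>
  have "((\<lambda>y. L y d (L x c u) \<bullet> L y c w) has_derivative
      (\<lambda>k. L x d (L x c u) \<bullet> dh x k w + dh x k (L x c u) \<bullet> L x c w)) (at x)"
    unfolding L_def[where u = w] L_def[where c = d]
    by (rule derivative_eq_intros deriv_h[OF x] refl)+ simp
  then have 1: "((\<lambda>y. L y d (L x c u) \<bullet> L y c w) has_derivative
      (\<lambda>k. dh x k (L x c u) \<bullet> L x c w)) (at x)"
    by (simp add: L_L[OF x cd])
  have "L y d v \<bullet> L y c w = 0" if "y \<in> D" for y v
    using L_L[OF that cd, of w] L_self_adjoint[OF that, of d v "L y c w"] by simp
  then have "((\<lambda>y. L y d (L x c u) \<bullet> L y c w) has_derivative (\<lambda>k. 0)) (at x)"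
    by (intro has_derivative_transform_within_open[OF has_derivative_const D x]) simp
  from fun_cong[OF has_derivative_unique[OF 1 this]] show ?thesis by (simp add: dh_inner[OF x])
qed

text \<open>
  The trilinear form \<open>\<langle>q(X, Y), A Z\<rangle>\<close> is symmetric in the first two arguments and, on one
  eigenspace, skew in the last two, hence it vanishes there.
\<close>

lemma cubic_form_zero:
  assumes x: "x \<in> D" and c: "c = a \<or> c = b"
  shows "q x (L x c u) (L x c v) \<bullet> A x (L x c w) = 0"
proof -
  let ?C = "\<lambda>u v w. q x (L x c u) (L x c v) \<bullet> A x (L x c w)"
  have sk: "?C u v w = - ?C u w v" for u v w
    using skew[OF x c, of "L x c u" v w] by (simp add: inner_commute)
  have sy: "?C u v w = ?C v u w" for u v w by (simp add: q_sym[OF x])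
  \<comment> \<open>Alternating the two rules six times returns to \<open>?C u v w\<close> after
    three sign changes, so it equals its negative.\<close>
  show ?thesis using sk[of u v w] sy[of u w v] sk[of w u v] sy[of w v u] sk[of v w u] sy[of v u w]
    by linarith
qed

text \<open>The Euclidean Laplacian of \<open>f\<close>.\<close>

definition S :: "'a \<Rightarrow> 'b" where "S x = (\<Sum>j\<in>Basis. q x j j)"

text \<open>\<open>L x c\<close> is self-adjoint and proportional to its square, so one factor can
  move to the other slot. Both arguments then lie in one eigenspace, where the cubic form
  vanishes.\<close>

lemma trace_L_square:
  assumes x: "x \<in> D" and c: "c = a \<or> c = b"
    and B1: "\<And>y. linear (\<lambda>x. B x y)" and B2: "\<And>x. linear (B x :: 'a \<Rightarrow> 'c::real_vector)"
  shows "(a + b - 2 * c) *\<^sub>R (\<Sum>j\<in>Basis. B j (L x c j)) = (\<Sum>j\<in>Basis. B (L x c j) (L x c j))"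
proof -
  have "(a + b - 2 * c) *\<^sub>R (\<Sum>j\<in>Basis. B j (L x c j)) = (\<Sum>j\<in>Basis. B j (L x c (L x c j)))"
    unfolding L_square[OF x c] by (simp add: linear_cmul[OF B2] scaleR_sum_right)
  also have "\<dots> = (\<Sum>j\<in>Basis. B (L x c j) (L x c j))"
    by (rule sum_Basis_self_adjoint[of "\<lambda>u w. B u (L x c w)"])
      (use B1 L_self_adjoint[OF x] linear_compose[OF linear_L[OF x] B2] in \<open>auto simp: o_def\<close>)
  finally show ?thesis .
qed

text \<open>Minimality makes the trace of \<open>q\<close> against \<open>(1 + a + b) - h\<close>
  vanish, so the trace against \<open>h\<close> is \<open>1 + a + b\<close> times the Laplacian;
  subtract \<open>c\<close> times the Laplacian.\<close>

lemma minimal_equation: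
  assumes x: "x \<in> D" and c: "c = a \<or> c = b"
  shows "(\<Sum>j\<in>Basis. q x j (L x c j)) = (1 + a + b - c) *\<^sub>R S x"
proof -
  obtain E where "orthonormal_basis (range (\<lambda>v. (v, A x v))) E" "(\<Sum>e\<in>E. q x (fst e) (fst e)) = 0"
    using minimal_graph_equation[OF x minimal[OF x]] .
  then have "(\<Sum>j\<in>Basis. q x j ((1 + a + b) *\<^sub>R j - h x j)) = 0"
    using sum_graph_orthonormal_basis[OF linear_A[OF x] quad[OF x] linear_q1[OF x] linear_q2[OF x]]
    by simp
  then show ?thesis
    by (simp add: S_def L_def linear_diff[OF linear_q2[OF x]] linear_cmul[OF linear_q2[OF x]]
        sum_subtractf scaleR_sum_right[symmetric] scaleR_left_diff_distrib)
qed

text \<open>For each \<open>c\<close>, \<open>S x\<close> is a nonzero multiple of a trace over the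
  range of \<open>L x c\<close>, hence orthogonal to the image of that range under
  \<open>A x\<close>. The two ranges span, as
  \<open>(a - b) *\<^sub>R v = L x b v - L x a v\<close>.\<close>

lemma laplacian_orthogonal:
  assumes x: "x \<in> D"
  shows "S x \<bullet> A x v = 0"
proof -
  have L0: "S x \<bullet> A x (L x c v) = 0" if c: "c = a \<or> c = b" for c
  proof -
    have "(a + b - 2 * c) *\<^sub>R (1 + a + b - c) *\<^sub>R S x = (\<Sum>j\<in>Basis. q x (L x c j) (L x c j))"
      using trace_L_square[OF x c linear_q1[OF x] linear_q2[OF x]] unfolding minimal_equation[OF x c] .
    then have "((a + b - 2 * c) *\<^sub>R (1 + a + b - c) *\<^sub>R S x) \<bullet> A x (L x c v) = 0"
      by (simp only: inner_sum_left cubic_form_zero[OF x c] sum.neutral_const)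
    \<comment> \<open>The first factor is \<open>a - b\<close> up to sign; the second is 1 plus the
      other, nonnegative value.\<close>
    moreover have "a + b - 2 * c \<noteq> 0" "1 + a + b - c \<noteq> 0" using ab c by auto
    ultimately show ?thesis by simp
  qed
  have "(a - b) *\<^sub>R v = L x b v - L x a v" by (simp add: L_def algebra_simps)
  then have "(a - b) * (S x \<bullet> A x v) = S x \<bullet> A x (L x b v - L x a v)"
    by (metis inner_scaleR_right linear_cmul[OF linear_A[OF x]])
  also have "\<dots> = 0" using L0 by (simp add: linear_diff[OF linear_A[OF x]] inner_diff_right)
  finally show ?thesis using ab by simp
qed

text \<open>By \<open>laplacian_orthogonal\<close> it suffices that \<open>S x\<close> lies in the
  image of \<open>A x\<close>. For \<open>b = 0\<close>, differentiating \<open>A h = a A\<close>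
  exhibits it there.\<close>

lemma laplacian_zero:
  assumes x: "x \<in> D"
  shows "S x = 0"
proof -
  have "\<exists>v. S x = A x v"
  proof (cases "b = 0")
    case False
    then have "surj (A x)" using surj_or_0 x by blast
    then show ?thesis by (metis surjD)
  next
    case b: True
    have Ah: "A y (h y u) = a *\<^sub>R A y u" if y: "y \<in> D" for y u
    proof -
      have "A y (L y a u) \<bullet> A y (L y a u) = h y (L y a u) \<bullet> L y a u" by (rule h_inner[OF y, symmetric])
      also have "h y (L y a u) = 0"
        using L_L[OF y, of a b u] b by (simp add: L_def)
      finally have "A y (L y a u) = 0" by simp
      then show ?thesis by (simp add: L_def linear_diff[OF linear_A[OF y]] linear_cmul[OF linear_A[OF y]])
    qed
    have q: "q x k (L x a u) = - A x (dh x k u)" for k u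
    proof -
      have 1: "((\<lambda>y. A y (h y u)) has_derivative (\<lambda>k. A x (dh x k u) + q x k (h x u))) (at x)"
        by (rule has_derivative_linear_apply[OF D x linear_A deriv_A[OF x] linear_q2[OF x] deriv_h[OF x]])
      have "((\<lambda>y. a *\<^sub>R A y u) has_derivative (\<lambda>k. a *\<^sub>R q x k u)) (at x)"
        by (rule has_derivative_scaleR_right[OF deriv_A[OF x]])
      then have 2: "((\<lambda>y. A y (h y u)) has_derivative (\<lambda>k. a *\<^sub>R q x k u)) (at x)"
        by (rule has_derivative_transform_within_open[OF _ D x]) (simp add: Ah)
      have "A x (dh x k u) + q x k (h x u) = a *\<^sub>R q x k u"
        using fun_cong[OF has_derivative_unique[OF 1 2]] .
      then show ?thesis
        by (simp add: L_def linear_diff[OF linear_q2[OF x]] linear_cmul[OF linear_q2[OF x]] algebra_simps)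
    qed
    \<comment> \<open>For \<open>c = a\<close> and \<open>b = 0\<close> the coefficient
      \<open>1 + a + b - c\<close> is exactly 1.\<close>
    have "S x = (\<Sum>j\<in>Basis. q x j (L x a j))" using minimal_equation[OF x, of a] b by simp
    also have "\<dots> = - A x (\<Sum>j\<in>Basis. dh x j j)"
      unfolding q by (simp add: linear_sum[OF linear_A[OF x]] sum_negf)
    also have "\<dots> = A x (- (\<Sum>j\<in>Basis. dh x j j))" by (simp add: linear_neg[OF linear_A[OF x]])
    finally show ?thesis by blast
  qed
  then obtain v where v: "S x = A x v" by blast
  have "S x \<bullet> S x = 0" using laplacian_orthogonal[OF x, of v] unfolding v[symmetric] .
  then show ?thesis by simp
qed

text \<open>The sum is half the derivative of \<open>tr h\<close> in direction \<open>k\<close>. On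
  each eigenspace \<open>skew\<close> with equal arguments kills every term, and the two
  contributions recombine.\<close>

lemma energy_density_critical:
  assumes x: "x \<in> D"
  shows "(\<Sum>i\<in>Basis. q x k i \<bullet> A x i) = 0"
proof -
  have B1: "linear (\<lambda>u. q x k u \<bullet> A x w)" and B2: "linear (\<lambda>w. q x k u \<bullet> A x w)" for u w
    using linear_q2[OF x, of k] linear_A[OF x] by (auto simp: linear_iff inner_simps)
  have L0: "(\<Sum>i\<in>Basis. q x k i \<bullet> A x (L x c i)) = 0" if c: "c = a \<or> c = b" for c
  proof -
    have "q x k (L x c i) \<bullet> A x (L x c i) = 0" for i
      using skew[OF x c, of k i i] by (simp add: inner_commute)
    then have "(a + b - 2 * c) * (\<Sum>i\<in>Basis. q x k i \<bullet> A x (L x c i)) = 0"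
      using trace_L_square[OF x c, of "\<lambda>u w. q x k u \<bullet> A x w", OF B1 B2] by simp
    moreover have "a + b - 2 * c \<noteq> 0" using ab c by auto
    ultimately show ?thesis by simp
  qed
  have "(a - b) * (\<Sum>i\<in>Basis. q x k i \<bullet> A x i) =
      (\<Sum>i\<in>Basis. q x k i \<bullet> A x (L x b i)) - (\<Sum>i\<in>Basis. q x k i \<bullet> A x (L x a i))"
    by (simp add: L_def linear_diff[OF linear_A[OF x]] linear_cmul[OF linear_A[OF x]] inner_diff_right
        sum_subtractf sum_distrib_left[symmetric] algebra_simps)
  then show ?thesis using L0 ab by simp
qed

text \<open>Bochner's argument: differentiate \<open>energy_density_critical\<close> in direction
  \<open>k\<close> and sum over \<open>k\<close>. The third-order term is the derivative of the
  Laplacian paired with \<open>Df\<close>, hence zero, and the squared norm of \<open>q\<close>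
  remains.\<close>

lemma second_derivative_zero:
  assumes x: "x \<in> D"
  shows "q x u v = 0"
proof -
  have rS: "(\<Sum>k\<in>Basis. r x i k k) = 0" for i
  proof -
    have 1: "(S has_derivative (\<lambda>w. \<Sum>k\<in>Basis. r x w k k)) (at x)"
      unfolding S_def[abs_def] by (intro has_derivative_sum deriv_q x)
    have 2: "(S has_derivative (\<lambda>w. 0)) (at x)"
      by (rule has_derivative_transform_within_open[OF has_derivative_const D x]) (simp add: laplacian_zero)
    show ?thesis using fun_cong[OF has_derivative_unique[OF 1 2]] .
  qed
  have bochner: "(\<Sum>i\<in>Basis. q x k i \<bullet> q x k i) = - (\<Sum>i\<in>Basis. r x k k i \<bullet> A x i)" for k
  proof -
    have 1: "((\<lambda>y. \<Sum>i\<in>Basis. q y k i \<bullet> A y i) has_derivative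
        (\<lambda>w. \<Sum>i\<in>Basis. q x k i \<bullet> q x w i + r x w k i \<bullet> A x i)) (at x)"
      by (intro has_derivative_sum has_derivative_inner deriv_q deriv_A x)
    have 2: "((\<lambda>y. \<Sum>i\<in>Basis. q y k i \<bullet> A y i) has_derivative (\<lambda>w. 0)) (at x)"
      by (rule has_derivative_transform_within_open[OF has_derivative_const D x])
        (simp add: energy_density_critical)
    show ?thesis using fun_cong[OF has_derivative_unique[OF 1 2], of k] by (simp add: sum.distrib)
  qed
  \<comment> \<open>Total symmetry of \<open>r\<close> moves \<open>i\<close> to the front, so that
    summing over \<open>k\<close> gives the derivative of \<open>S\<close>.\<close>
  have "(\<Sum>k\<in>Basis. \<Sum>i\<in>Basis. q x k i \<bullet> q x k i) = - (\<Sum>k\<in>Basis. \<Sum>i\<in>Basis. r x i k k \<bullet> A x i)"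
    unfolding bochner sum_negf by (intro arg_cong[where f = uminus] sum.cong refl) (metis r_sym[OF x])
  also have "\<dots> = - (\<Sum>i\<in>Basis. (\<Sum>k\<in>Basis. r x i k k) \<bullet> A x i)"
    by (subst sum.swap) (simp add: inner_sum_left)
  also have "\<dots> = 0" by (simp add: rS)
  finally have "(\<Sum>i\<in>Basis. q x k i \<bullet> q x k i) = 0" if "k \<in> Basis" for k
    using that sum_nonneg_eq_0_iff[of "Basis :: 'a set" "\<lambda>k. \<Sum>i\<in>Basis. q x k i \<bullet> q x k i"]
    by (simp add: sum_nonneg)
  then have q0: "q x k i = 0" if "k \<in> Basis" "i \<in> Basis" for k i
    using that sum_nonneg_eq_0_iff[of "Basis :: 'a set" "\<lambda>i. q x k i \<bullet> q x k i"] by simp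
  have z: "linear (\<lambda>_ :: 'a. 0 :: 'b)" by (simp add: linear_zero)
  have "q x k v = 0" if "k \<in> Basis" for k
    using linear_eq_stdbasis[OF linear_q2[OF x] z] q0[OF that] by metis
  then show ?thesis
    using linear_eq_stdbasis[OF linear_q1[OF x] z] by metis
qed

lemma affine_linear:
  assumes conn: "connected D"
  obtains F c where "linear F" "\<And>x. x \<in> D \<Longrightarrow> f x = F x + c"
proof (cases "D = {}")
  case True
  then show ?thesis using that[of "\<lambda>_. 0" 0] linear_zero by auto
next
  case False
  then obtain x0 where x0: "x0 \<in> D" by blast
  have const: "g constant_on D" if "\<And>x. x \<in> D \<Longrightarrow> (g has_derivative (\<lambda>_. 0)) (at x)" for g :: "'a \<Rightarrow> 'b"
  proof (rule has_derivative_zero_connected_constant_on[OF conn D finite.emptyI])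
    show d: "\<forall>x\<in>D - {}. (g has_derivative (\<lambda>_. 0)) (at x within D)"
      using that by (blast intro: has_derivative_at_withinI)
    show "continuous_on D g"
      by (rule has_derivative_continuous_on[where f' = "\<lambda>_ _. 0"]) (use d in blast)
  qed
  have Aconst: "A x v = A x0 v" if "x \<in> D" for x v
  proof -
    have "(\<lambda>y. A y v) constant_on D"
      using const deriv_A[where v = v] by (simp add: second_derivative_zero)
    then show ?thesis using that x0 unfolding constant_on_def by metis
  qed
  have "(\<lambda>y. f y - A x0 y) constant_on D"
  proof (rule const)
    fix x assume x: "x \<in> D"
    have "(A x0 has_derivative A x0) (at x)" by (rule linear_imp_has_derivative[OF linear_A[OF x0]])
    from has_derivative_diff[OF deriv_f[OF x] this]
    show "((\<lambda>y. f y - A x0 y) has_derivative (\<lambda>_. 0)) (at x)" by (simp add: Aconst[OF x])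
  qed
  then obtain c where "\<And>x. x \<in> D \<Longrightarrow> f x - A x0 x = c" unfolding constant_on_def by blast
  then have "f x = A x0 x + c" if "x \<in> D" for x using that by (metis diff_add_cancel add.commute)
  then show ?thesis using that linear_A[OF x0] by blast
qed

end

section \<open>Graphs of affine maps as affine planes\<close>

lemma affine_graph:
  fixes F :: "'a::euclidean_space \<Rightarrow> 'b::euclidean_space"
  assumes "linear F"
  shows "affine (range (\<lambda>x. (x, F x + c)))" "aff_dim (range (\<lambda>x. (x, F x + c))) = int DIM('a)"
proof -
  let ?g = "\<lambda>x. (x, F x)"
  have g: "linear ?g" using assms by (simp add: linear_iff)
  have eq: "range (\<lambda>x. (x, F x + c)) = (+) (0, c) ` range ?g" by (auto simp: image_iff add.commute)
  have "subspace (range ?g)" using g subspace_UNIV by (rule linear_subspace_image)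
  then show "affine (range (\<lambda>x. (x, F x + c)))"
    unfolding eq affine_translation[symmetric] by (rule subspace_imp_affine)
  have "inj ?g" by (rule injI) simp
  then show "aff_dim (range (\<lambda>x. (x, F x + c))) = int DIM('a)"
    unfolding eq aff_dim_translation_eq aff_dim_injective_linear_image[OF g \<open>inj ?g\<close>] by simp
qed

theorem theorem1p1:
  fixes D :: "(real ^ 'n) set"
    and f :: "real ^ 'n \<Rightarrow> real ^ 'm"
    and M Q\<^sub>0 :: "((real ^ 'n) \<times> (real ^ 'm)) set"
  defines "M \<equiv> {(x, f x) | x. x \<in> D}"
    and "Q\<^sub>0 \<equiv> {0} \<times> UNIV"
  assumes "open D" and "connected D"
    and "smooth_on D f"
    and "minimal_submanifold M"
    and "constant_jordan_angles M Q\<^sub>0"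
    and "\<forall>p\<in>M. gN M Q\<^sub>0 p \<le> 2"
    and "\<forall>p\<in>M. gT M Q\<^sub>0 p \<le> 2"
  shows "(\<exists>A b. linear A \<and> (\<forall>x\<in>D. f x = A x + b)) \<and>
         (\<exists>S. affine S \<and> aff_dim S = int CARD('n) \<and> openin (top_of_set S) M)"
proof -
  interpret smooth_graph D f using assms by unfold_locales auto
  have gN: "gN {(x, f x) | x. x \<in> D} ({0} \<times> UNIV) (x, f x) \<le> 2"
    and gT: "gT {(x, f x) | x. x \<in> D} ({0} \<times> UNIV) (x, f x) \<le> 2"
    and H: "mean_curvature {(x, f x) | x. x \<in> D} (x, f x) = 0" if "x \<in> D" for x
    using assms(6,8,9) that unfolding M_def Q\<^sub>0_def minimal_submanifold_def by auto
  have "\<exists>F c. linear F \<and> (\<forall>x\<in>D. f x = F x + c)"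
  proof (cases "D = {}")
    case True
    then show ?thesis using linear_zero by blast
  next
    case False
    then obtain x0 where "x0 \<in> D" by blast
    from two_singular_values[OF assms(7)[unfolded M_def Q\<^sub>0_def] gN gT this]
    obtain a b where ab: "a \<noteq> b" "a \<ge> 0" "b \<ge> 0"
      "\<And>x u. x \<in> D \<Longrightarrow> h x (h x u) = (a + b) *\<^sub>R h x u - (a * b) *\<^sub>R u"
      "b = 0 \<or> (\<forall>x\<in>D. surj (A x))"
      by metis
    interpret two_value_minimal_graph D f a b by unfold_locales (use ab H in auto)
    show ?thesis using affine_linear[OF \<open>connected D\<close>] by metis
  qed
  then obtain F c where F: "linear F" "\<And>x. x \<in> D \<Longrightarrow> f x = F x + c" by blast
  \<comment> \<open>\<open>M\<close> is the part of the affine plane inside the open cylinder over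
    \<open>D\<close>, hence relatively open.\<close>
  have "M = range (\<lambda>x. (x, F x + c)) \<inter> (D \<times> UNIV)" unfolding M_def using F(2) by auto
  then have "openin (top_of_set (range (\<lambda>x. (x, F x + c)))) M"
    using open_Times[OF \<open>open D\<close> open_UNIV] by (auto simp: openin_open)
  with affine_graph[OF F(1), of c] F show ?thesis by auto
qed

end
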